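(* Assume the setting described in the context, where $(X_i,Y_i)_{i=1}^n$ is stationary $\beta$-mixing with coefficients $\beta(\cdot)$. Let $\alpha\in(0,1)$ and $\delta_{\mathrm{cal}}>0$. Then for $i\in I_{\mathrm{test}}$, \[\mathbb{P}[Y_i\in C_{1-\alpha}(X_i)]\ge 1-\alpha-\eta,\qquad \eta=\varepsilon_{\mathrm{cal}}+\varepsilon_{\mathrm{train}}+\delta_{\mathrm{cal}},\] where $\varepsilon_{\mathrm{train}}=\beta(i-n_{\mathrm{train}})$ and \[\varepsilon_{\mathrm{cal}}=\inf_{(a,m,r)\in F_{\mathrm{cal}}}\left\{\widetilde{\sigma}(a)\sqrt{\frac{4}{n_{\mathrm{cal}}-r+1}\log\left(\frac{4}{\delta_{\mathrm{cal}}-4(m-1)\beta(a)-\beta(r)}\right)}+\frac{1}{3m}\log\left(\frac{4}{\delta_{\mathrm{cal}}-4(m-1)\beta(a)-\beta(r)}\right)+\frac{r-1}{n_{\mathrm{cal}}}\right\},\] with $F_{\mathrm{cal}}=\{(a,m,r)\in\mathbb{N}_{>0}^3: 2ma=n_{\mathrm{cal}}-r+1,\ \delta_{\mathrm{cal}}>4(m-1)\beta(a)+\beta(r)\}$ and $\widetilde{\sigma}(a)=\sqrt{\frac14+\frac{2}{a}\sum_{j=1}^{a-1}(a-j)\beta(j)}$. Additionally, if $\widehat{s}_{\mathrm{train}}(X_*,Y_* )$ almost surely has a continuous distribution conditionally on the training data, then $|\mathbb{P}[Y_i\in C_{1-\alpha}(X_i)]-(1-\alpha)|\le\eta$.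
   Context: Let $\mathcal{X},\mathcal{Y}$ be measurable spaces. A stochastic process $\{Z_t\}_{t\in\mathbb{Z}}$ is stationary if $(Z_t,\dots,Z_{t+m})\overset{d}{=}(Z_{t+k},\dots,Z_{t+m+k})$ for all $t\in\mathbb{Z}$, $m,k\in\mathbb{N}$; its $\beta$-mixing coefficient at $a\in\mathbb{N}$ is $\beta(a)=\|\mathbb{P}_{-\infty:0,a:\infty}-\mathbb{P}_{-\infty:0}\otimes\mathbb{P}_{a:\infty}\|_{\mathrm{TV}}$, where $\mathbb{P}_{-\infty:0,a:\infty}$ is the joint law of the blocks $(Z_{-\infty:0},Z_{a:\infty})$ and $\mathbb{P}_{-\infty:0}$, $\mathbb{P}_{a:\infty}$ are the laws of the individual blocks; it is $\beta$-mixing if $\beta(a)\to0$. "The sample $(X_i,Y_i)_{i=1}^n$ is stationary $\beta$-mixing" means $(X_i,Y_i)=Z_i$, $i=1,\dots,n$, for such a process $\{Z_t\}$ with values in $\mathcal{X}\times\mathcal{Y}$. Let $(X_*,Y_* )$ be a random pair independent of the sample with $(X_*,Y_* )\sim(X_1,Y_1)$. Write $n=n_{\mathrm{train}}+n_{\mathrm{cal}}+n_{\mathrm{test}}$ with positive integers, $I_{\mathrm{train}}=\{1,\dots,n_{\mathrm{train}}\}$, $I_{\mathrm{cal}}=\{n_{\mathrm{train}}+1,\dots,n_{\mathrm{train}}+n_{\mathrm{cal}}\}$, $I_{\mathrm{test}}=\{n_{\mathrm{train}}+n_{\mathrm{cal}}+1,\dots,n\}$. Let $s:(\mathcal{X}\times\mathcal{Y})^{n_{\mathrm{train}}+1}\to\mathbb{R}$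 be any (measurable) function and $\widehat{s}_{\mathrm{train}}(x,y)=s((X_i,Y_i)_{i\in I_{\mathrm{train}}},(x,y))$. For $\phi\in[0,1)$, $\widehat{q}_{\phi,\mathrm{cal}}=\inf\{t\in\mathbb{R}:\frac{1}{n_{\mathrm{cal}}}\sum_{i\in I_{\mathrm{cal}}}\mathbf{1}\{\widehat{s}_{\mathrm{train}}(X_i,Y_i)\le t\}\ge\phi\}$ and $C_\phi(x)=\{y\in\mathcal{Y}:\widehat{s}_{\mathrm{train}}(x,y)\le\widehat{q}_{\phi,\mathrm{cal}}\}$. An infimum over the empty set is $+\infty$. *)

theory Defs
  imports "HOL-Probability.Probability"
begin

definition tv_dist :: "'a measure \<Rightarrow> 'a measure \<Rightarrow> real" where
  "tv_dist P Q = (SUP C\<in>sets P. \<bar>measure P C - measure Q C\<bar>)"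

definition stationary_proc :: "'a measure \<Rightarrow> 'b measure \<Rightarrow> (int \<Rightarrow> 'a \<Rightarrow> 'b) \<Rightarrow> bool" where
  "stationary_proc M N Z \<longleftrightarrow>
     (\<forall>t::int. \<forall>m k::nat.
        distr M (Pi\<^sub>M {0..m} (\<lambda>_. N)) (\<lambda>\<omega>. \<lambda>j\<in>{0..m}. Z (t + int j) \<omega>) =
        distr M (Pi\<^sub>M {0..m} (\<lambda>_. N)) (\<lambda>\<omega>. \<lambda>j\<in>{0..m}. Z (t + int k + int j) \<omega>))"

definition past_block :: "(int \<Rightarrow> 'a \<Rightarrow> 'b) \<Rightarrow> 'a \<Rightarrow> int \<Rightarrow> 'b" where
  "past_block Z \<omega> = (\<lambda>t\<in>{..0}. Z t \<omega>)"

definition future_block :: "(int \<Rightarrow> 'a \<Rightarrow> 'b) \<Rightarrow> nat \<Rightarrow> 'a \<Rightarrow> int \<Rightarrow> 'b" where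
  "future_block Z a \<omega> = (\<lambda>t\<in>{int a..}. Z t \<omega>)"

definition beta_mix_coef :: "'a measure \<Rightarrow> 'b measure \<Rightarrow> (int \<Rightarrow> 'a \<Rightarrow> 'b) \<Rightarrow> nat \<Rightarrow> real" where
  "beta_mix_coef M N Z a =
     tv_dist
       (distr M (Pi\<^sub>M {..0} (\<lambda>_. N) \<Otimes>\<^sub>M Pi\<^sub>M {int a..} (\<lambda>_. N))
          (\<lambda>\<omega>. (past_block Z \<omega>, future_block Z a \<omega>)))
       (distr M (Pi\<^sub>M {..0} (\<lambda>_. N)) (past_block Z) \<Otimes>\<^sub>M
        distr M (Pi\<^sub>M {int a..} (\<lambda>_. N)) (future_block Z a))"

text \<open>Empirical phi-quantile of the scores S i, i in the calibration index set I,
  as an extended real (infimum of the empty set is +infinity).\<close>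
definition cal_quantile :: "real \<Rightarrow> nat set \<Rightarrow> (nat \<Rightarrow> real) \<Rightarrow> ereal" where
  "cal_quantile \<phi> I S =
     Inf {ereal t | t. real (card {i\<in>I. S i \<le> t}) / real (card I) \<ge> \<phi>}"

definition conf_set :: "((nat \<Rightarrow> 'x \<times> 'y) \<Rightarrow> 'x \<times> 'y \<Rightarrow> real) \<Rightarrow> (nat \<Rightarrow> 'x \<times> 'y) \<Rightarrow> ereal \<Rightarrow> 'x \<Rightarrow> 'y set" where
  "conf_set s D q x = {y. ereal (s D (x, y)) \<le> q}"

definition sigma_tilde :: "(nat \<Rightarrow> real) \<Rightarrow> nat \<Rightarrow> real" where
  "sigma_tilde \<beta> a = sqrt (1/4 + 2 / real a * (\<Sum>j=1..a-1. (real a - real j) * \<beta> j))"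

definition F_cal :: "(nat \<Rightarrow> real) \<Rightarrow> nat \<Rightarrow> real \<Rightarrow> (nat \<times> nat \<times> nat) set" where
  "F_cal \<beta> n_cal \<delta> = {(a, m, r). a > 0 \<and> m > 0 \<and> r > 0 \<and>
      real (2 * m * a) = real n_cal - real r + 1 \<and>
      \<delta> > 4 * (real m - 1) * \<beta> a + \<beta> r}"

definition eps_cal :: "(nat \<Rightarrow> real) \<Rightarrow> nat \<Rightarrow> real \<Rightarrow> ereal" where
  "eps_cal \<beta> n_cal \<delta> =
     (INF (a, m, r)\<in>F_cal \<beta> n_cal \<delta>.
        ereal (sigma_tilde \<beta> a *
                 sqrt (4 / (real n_cal - real r + 1) *
                       ln (4 / (\<delta> - 4 * (real m - 1) * \<beta> a - \<beta> r)))
               + 1 / (3 * real m) * ln (4 / (\<delta> - 4 * (real m - 1) * \<beta> a - \<beta> r))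
               + (real r - 1) / real n_cal))"

end

theory Submission
  imports Defs
begin

text \<open>
  Given the training data \<open>d\<close>, compare the empirical quantile with the quantile \<open>Q(d)\<close> of the score
  of an independent point at level \<open>1 - \<alpha> \<mp> \<epsilon>\<close>. Since \<open>Q(d)\<close> does not depend on the calibration
  data, the test point only has to be decoupled from the training data, at cost
  \<open>\<beta>(i - n_train)\<close>. If coverage is not governed by \<open>Q(d)\<close>, then the calibration scores visit
  \<open>{s d < Q d}\<close> (respectively \<open>{s d > Q d}\<close>) too often. To bound this probability, drop the first
  \<open>r - 1\<close> calibration points, decouple the others from the training data at cost \<open>\<beta>(r)\<close>, and cut
  them into \<open>2 m\<close> blocks of length \<open>a\<close>. The law of the sum over every second block is within
  \<open>(m - 1) \<beta>(a)\<close> of an \<open>m\<close>-fold convolution power, whose tail is bounded by the sub-gamma form of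
  Bernstein's inequality with the block variance at most \<open>\<sigma>(a)\<^sup>2 / a\<close>.
\<close>

section \<open>Bernstein's inequality for convolution powers\<close>

text \<open>The calibration threshold is random and depends on all calibration scores, which
  suggests a deviation bound uniform over thresholds, with its extra cost. This is avoided: coverage
  is rewritten as a count of strictly smaller scores, and that count only has to be compared at the
  single point \<open>Q d\<close>. So one set per value of the training data is enough, and
  Bernstein for one indicator suffices. Blocks are never coupled with independent copies; only laws
  are compared, so no enlarged probability space occurs. The variance at lag zero is at most
  \<open>1/4\<close> and each covariance is at most a mixing coefficient, which is the origin of
  \<open>sigma_tilde\<close>. Two situations fall outside the scheme and are shown to make the bound
  vacuous: a shifted level outside the open unit interval, where no quantile exists, and a negative
  logarithm.\<close>

lemma fact_ge_two_three_power: "2 * 3 ^ n \<le> (fact (n + 2) :: real)"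
proof (induction n)
  case (Suc n)
  have "2 * 3 ^ Suc n = 3 * (2 * 3 ^ n :: real)" by simp
  also have "\<dots> \<le> real (n + 3) * fact (n + 2)"
    using Suc by (intro mult_mono) auto
  also have "\<dots> = fact (Suc n + 2)" by (simp add: fact_reduce)
  finally show ?case .
qed simp

text \<open>Since \<open>(n + 2)!\<close> is at least \<open>2 * 3 ^ n\<close>, the exponential
  series past its linear term is dominated by \<open>x\<^sup>2 * l\<^sup>2 / 2\<close> times a
  geometric series of ratio \<open>l / 3\<close>; hence the restriction \<open>l < 3\<close>. The
  factor \<open>x\<^sup>2\<close> is kept so that integration yields the variance rather than the
  range.\<close>

lemma exp_le_sub_gamma:
  fixes x l :: real
  assumes x: "\<bar>x\<bar> \<le> 1" and l: "0 \<le> l" "l < 3"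
  shows "exp (l * x) \<le> 1 + l * x + x\<^sup>2 * (l\<^sup>2 / (2 * (1 - l / 3)))"
proof -
  have "(\<lambda>n. (l * x) ^ n /\<^sub>R fact n) sums exp (l * x)"
    by (rule exp_converges)
  then have "(\<lambda>n. (l * x) ^ (n + 2) /\<^sub>R fact (n + 2)) sums
      (exp (l * x) - (\<Sum>i<2. (l * x) ^ i /\<^sub>R fact i))"
    by (rule sums_split_initial_segment)
  then have s1: "(\<lambda>n. (l * x) ^ (n + 2) /\<^sub>R fact (n + 2)) sums (exp (l * x) - 1 - l * x)"
    by (simp add: numeral_2_eq_2 algebra_simps)
  have "(\<lambda>n. (l / 3) ^ n) sums (1 / (1 - l / 3))"
    using l by (intro geometric_sums) auto
  then have s2: "(\<lambda>n. (x\<^sup>2 * l\<^sup>2 / 2) * (l / 3) ^ n) sums ((x\<^sup>2 * l\<^sup>2 / 2) * (1 / (1 - l / 3)))"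
    by (rule sums_mult)
  have "(l * x) ^ (n + 2) /\<^sub>R fact (n + 2) \<le> (x\<^sup>2 * l\<^sup>2 / 2) * (l / 3) ^ n" for n
  proof -
    have "x ^ n \<le> 1"
      using x power_le_one[of "\<bar>x\<bar>" n] by (metis abs_ge_zero abs_le_D1 power_abs)
    then have "x\<^sup>2 * l ^ (n + 2) * x ^ n \<le> x\<^sup>2 * l ^ (n + 2)"
      using l by (intro mult_left_le) auto
    moreover have "(l * x) ^ (n + 2) = x\<^sup>2 * l ^ (n + 2) * x ^ n"
      unfolding power_add power_mult_distrib by (simp only: mult_ac)
    ultimately have "(l * x) ^ (n + 2) \<le> x\<^sup>2 * l ^ (n + 2)" by (simp only:)
    then have "(l * x) ^ (n + 2) /\<^sub>R fact (n + 2) \<le> x\<^sup>2 * l ^ (n + 2) / fact (n + 2)"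
      by (simp add: divide_simps)
    also have "\<dots> \<le> x\<^sup>2 * l ^ (n + 2) / (2 * 3 ^ n)"
      using l fact_ge_two_three_power[of n] by (intro divide_left_mono) auto
    also have "\<dots> = (x\<^sup>2 * l\<^sup>2 / 2) * (l / 3) ^ n"
      by (simp add: power_add power_divide power2_eq_square)
    finally show ?thesis .
  qed
  from sums_le[OF this s1 s2] show ?thesis by simp
qed

text \<open>Centring removes the linear term of \<open>exp_le_sub_gamma\<close>, and
  \<open>1 + u \<le> exp u\<close> gives a form suited to products. With the nonnegative integral,
  the exponential moment of a convolution power is a power without any integrability to
  check.\<close>

lemma (in prob_space) expectation_exp_le_sub_gamma:
  fixes X :: "'a \<Rightarrow> real"
  assumes X[measurable]: "X \<in> borel_measurable M" and bd: "AE \<omega> in M. \<bar>X \<omega>\<bar> \<le> 1"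
    and mean: "expectation X = 0" and var: "expectation (\<lambda>\<omega>. (X \<omega>)\<^sup>2) \<le> v"
    and l: "0 \<le> l" "l < 3"
  shows "(\<integral>\<^sup>+\<omega>. ennreal (exp (l * X \<omega>)) \<partial>M) \<le> ennreal (exp (v * (l\<^sup>2 / (2 * (1 - l / 3)))))"
proof -
  define c where "c = l\<^sup>2 / (2 * (1 - l / 3))"
  have c: "c \<ge> 0" using l by (auto simp: c_def)
  have iX: "integrable M X"
    by (rule integrable_const_bound[where B=1]) (use bd in \<open>auto elim: eventually_mono\<close>)
  have iX2: "integrable M (\<lambda>\<omega>. (X \<omega>)\<^sup>2)"
    by (rule integrable_const_bound[where B=1]) (use bd in \<open>auto simp: abs_square_le_1 elim: eventually_mono\<close>)
  have ie: "integrable M (\<lambda>\<omega>. exp (l * X \<omega>))"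
  proof (rule integrable_const_bound[where B="exp l"])
    show "AE \<omega> in M. norm (exp (l * X \<omega>)) \<le> exp l"
      using bd l by (auto intro!: mult_left_le dest: abs_le_D1 elim!: eventually_mono)
  qed simp
  have "expectation (\<lambda>\<omega>. exp (l * X \<omega>)) \<le> expectation (\<lambda>\<omega>. 1 + l * X \<omega> + (X \<omega>)\<^sup>2 * c)"
    unfolding c_def using bd l
    by (intro integral_mono_AE ie Bochner_Integration.integrable_add integrable_mult_right
          integrable_mult_left iX iX2 integrable_const) (auto dest: exp_le_sub_gamma elim!: eventually_mono)
  also have "\<dots> = 1 + expectation (\<lambda>\<omega>. (X \<omega>)\<^sup>2) * c"
    using iX iX2 mean by (simp add: prob_space)
  also have "\<dots> \<le> 1 + v * c" using var c by (simp add: mult_right_mono)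
  also have "\<dots> \<le> exp (v * c)" by (simp add: exp_ge_add_one_self)
  finally show ?thesis
    by (subst nn_integral_eq_integral[OF ie]) (auto simp: c_def)
qed

text \<open>This is the law of a sum of \<open>k\<close> independent variables with law
  \<open>\<mu>\<close>. It is built on the reals alone, so no independent copies of the blocks have
  to be constructed, and the recursion matches the induction over blocks.\<close>

primrec convolution_power :: "real measure \<Rightarrow> nat \<Rightarrow> real measure" where
  "convolution_power \<mu> 0 = return borel 0"
| "convolution_power \<mu> (Suc k) = distr (convolution_power \<mu> k \<Otimes>\<^sub>M \<mu>) borel (\<lambda>(x, y). x + y)"

lemma sets_convolution_power [simp, measurable_cong]: "sets (convolution_power \<mu> k) = sets borel"
  by (cases k) auto

lemma prob_space_convolution_power:
  assumes "prob_space \<mu>" and [measurable_cong]: "sets \<mu> = sets borel"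
  shows "prob_space (convolution_power \<mu> k)"
proof (induction k)
  case 0
  then show ?case by (simp add: prob_space_return)
next
  case (Suc k)
  interpret pair_prob_space "convolution_power \<mu> k" \<mu>
    using Suc assms(1) by (simp add: pair_prob_space_def pair_sigma_finite_def prob_space_imp_sigma_finite)
  show ?case
    by (auto intro!: prob_space_distr)
qed

lemma nn_integral_exp_convolution_power:
  assumes "prob_space \<mu>" and [measurable_cong]: "sets \<mu> = sets borel"
  shows "(\<integral>\<^sup>+x. ennreal (exp (l * x)) \<partial>convolution_power \<mu> k) = (\<integral>\<^sup>+x. ennreal (exp (l * x)) \<partial>\<mu>) ^ k"
proof (induction k)
  case 0
  then show ?case by (simp add: nn_integral_return)
next
  case (Suc k)
  interpret prob_space \<mu> by fact
  have "(\<integral>\<^sup>+x. ennreal (exp (l * x)) \<partial>convolution_power \<mu> (Suc k)) =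
      (\<integral>\<^sup>+z. ennreal (exp (l * fst z)) * ennreal (exp (l * snd z)) \<partial>(convolution_power \<mu> k \<Otimes>\<^sub>M \<mu>))"
    by (simp add: nn_integral_distr split_beta' distrib_left exp_add ennreal_mult)
  also have "\<dots> = (\<integral>\<^sup>+x. \<integral>\<^sup>+y. ennreal (exp (l * x)) * ennreal (exp (l * y)) \<partial>\<mu> \<partial>convolution_power \<mu> k)"
    by (subst nn_integral_fst[symmetric]) auto
  also have "\<dots> = (\<integral>\<^sup>+x. ennreal (exp (l * x)) \<partial>\<mu>) ^ Suc k"
    by (simp add: nn_integral_cmult nn_integral_multc Suc[symmetric]) (simp add: mult.commute Suc)
  finally show ?case .
qed

text \<open>Chernoff's method with the optimal exponent. The threshold per summand is the point
  where the conjugate of the sub-gamma cumulant bound, with variance factor \<open>v\<close> and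
  scale \<open>1 / 3\<close>, takes the value \<open>L / m\<close>.\<close>

lemma convolution_power_sub_gamma_tail:
  fixes v L :: real
  assumes \<mu>: "prob_space \<mu>" and [measurable_cong]: "sets \<mu> = sets borel"
    and bd: "AE x in \<mu>. \<bar>x\<bar> \<le> 1"
    and mean: "(\<integral>x. x \<partial>\<mu>) = 0" and var: "(\<integral>x. x\<^sup>2 \<partial>\<mu>) \<le> v"
    and v: "v > 0" and L: "L \<ge> 0" and m: "m > 0"
  shows "measure (convolution_power \<mu> m) {x. x \<ge> real m * (sqrt (2 * v * L / m) + L / (3 * m))} \<le> exp (- L)"
proof -
  interpret prob_space \<mu> by fact
  interpret C: prob_space "convolution_power \<mu> m"
    by (rule prob_space_convolution_power) fact+
  define u where "u = L / m"
  define w where "w = sqrt (2 * u / v)"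
  \<comment> \<open>This \<open>l\<close> maximises
    \<open>l * t - v * l^2 / (2 * (1 - l / 3))\<close>, with maximum exactly \<open>u\<close>. It
    stays below 3 for every \<open>w \<ge> 0\<close>, so the cumulant bound applies.\<close>
  define l where "l = w / (1 + w / 3)"
  define t where "t = sqrt (2 * v * L / m) + L / (3 * m)"
  have u: "u \<ge> 0" and w: "w \<ge> 0" using L v by (auto simp: u_def w_def)
  have l: "0 \<le> l" "l < 3" using w by (auto simp: l_def field_simps)
  have w2: "v * w\<^sup>2 = 2 * u" using u v by (simp add: w_def)
  have "sqrt (2 * v * L / m) = sqrt (v\<^sup>2 * (2 * u / v))"
    using v by (simp add: u_def power2_eq_square)
  also have "\<dots> = v * w" unfolding w_def real_sqrt_mult using v by simp
  finally have t: "t = v * w + u / 3" by (simp add: t_def u_def)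
  have l1: "1 - l / 3 = 1 / (1 + w / 3)" using w by (simp add: l_def field_simps)
  have "v * (l\<^sup>2 / (2 * (1 - l / 3))) = (v * w\<^sup>2) / (2 * (1 + w / 3))"
    unfolding l1 using w by (simp add: l_def power_divide power2_eq_square)
  also have "\<dots> = u / (1 + w / 3)" unfolding w2 using w by (simp add: divide_simps)
  finally have cum: "v * (l\<^sup>2 / (2 * (1 - l / 3))) = u / (1 + w / 3)" .
  have "l * t = (v * w\<^sup>2 + u * w / 3) / (1 + w / 3)"
    unfolding t l_def by (simp add: power2_eq_square algebra_simps)
  also have "\<dots> = u + u / (1 + w / 3)"
    unfolding w2 using w by (simp add: field_simps)
  finally have lt: "l * t = u + u / (1 + w / 3)" .
  have mgf: "(\<integral>\<^sup>+x. ennreal (exp (l * x)) \<partial>\<mu>) \<le> ennreal (exp (u / (1 + w / 3)))"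
    unfolding cum[symmetric]
    by (rule expectation_exp_le_sub_gamma) (use bd mean var l in auto)
  have "emeasure (convolution_power \<mu> m) {x. x \<ge> m * t} =
      (\<integral>\<^sup>+x. indicator {x. x \<ge> m * t} x \<partial>convolution_power \<mu> m)"
    by simp
  \<comment> \<open>Markov's inequality, as the pointwise bound of the indicator by
    \<open>exp (l * (x - m * t))\<close>.\<close>
  also have "\<dots> \<le> (\<integral>\<^sup>+x. ennreal (exp (- (l * (m * t)))) * ennreal (exp (l * x)) \<partial>convolution_power \<mu> m)"
    using l by (intro nn_integral_mono)
      (auto simp: indicator_def ennreal_mult[symmetric] exp_add[symmetric] mult_left_mono
            simp flip: ennreal_1 intro!: ennreal_leI)
  also have "\<dots> = ennreal (exp (- (l * (m * t)))) * (\<integral>\<^sup>+x. ennreal (exp (l * x)) \<partial>\<mu>) ^ m"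
    using \<mu> assms(2) by (simp add: nn_integral_cmult nn_integral_exp_convolution_power)
  also have "\<dots> \<le> ennreal (exp (- (l * (m * t)))) * ennreal (exp (u / (1 + w / 3))) ^ m"
    by (intro mult_left_mono power_mono mgf) auto
  also have "\<dots> = ennreal (exp (- (m * (l * t)) + m * (u / (1 + w / 3))))"
    by (simp add: ennreal_power exp_of_nat_mult[symmetric] ennreal_mult[symmetric] exp_add[symmetric] algebra_simps)
  also have "- (m * (l * t)) + m * (u / (1 + w / 3)) = - L"
    unfolding lt using m by (simp add: u_def field_simps)
  finally show ?thesis
    by (simp add: C.emeasure_eq_measure t_def)
qed

section \<open>Decoupling of blocks of a stationary process\<close>

lemma (in pair_prob_space) measure_pair_eq_integral_fst:
  assumes C: "C \<in> sets (M1 \<Otimes>\<^sub>M M2)"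
  shows "integrable M1 (\<lambda>x. measure M2 (Pair x -` C))"
    and "measure (M1 \<Otimes>\<^sub>M M2) C = (\<integral>x. measure M2 (Pair x -` C) \<partial>M1)"
proof -
  have [measurable]: "(\<lambda>x. measure M2 (Pair x -` C)) \<in> borel_measurable M1"
    using M2.measurable_emeasure_Pair[OF C] unfolding measure_def by measurable
  show i: "integrable M1 (\<lambda>x. measure M2 (Pair x -` C))"
    by (rule M1.integrable_const_bound[where B=1]) auto
  have "emeasure (M1 \<Otimes>\<^sub>M M2) C = (\<integral>\<^sup>+x. ennreal (measure M2 (Pair x -` C)) \<partial>M1)"
    using C by (simp add: M2.emeasure_pair_measure_alt M2.emeasure_eq_measure)
  also have "\<dots> = ennreal (\<integral>x. measure M2 (Pair x -` C) \<partial>M1)"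
    using i by (intro nn_integral_eq_integral) auto
  finally show "measure (M1 \<Otimes>\<^sub>M M2) C = (\<integral>x. measure M2 (Pair x -` C) \<partial>M1)"
    by (simp add: measure_def)
qed

lemma (in pair_prob_space) measure_pair_eq_integral_snd:
  assumes C: "C \<in> sets (M1 \<Otimes>\<^sub>M M2)"
  shows "integrable M2 (\<lambda>y. measure M1 ((\<lambda>x. (x, y)) -` C))"
    and "measure (M1 \<Otimes>\<^sub>M M2) C = (\<integral>y. measure M1 ((\<lambda>x. (x, y)) -` C) \<partial>M2)"
proof -
  have [measurable]: "(\<lambda>y. measure M1 ((\<lambda>x. (x, y)) -` C)) \<in> borel_measurable M2"
    using measurable_emeasure_Pair2[OF C] unfolding measure_def by measurable
  show i: "integrable M2 (\<lambda>y. measure M1 ((\<lambda>x. (x, y)) -` C))"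
    by (rule M2.integrable_const_bound[where B=1]) auto
  have "emeasure (M1 \<Otimes>\<^sub>M M2) C = (\<integral>\<^sup>+y. ennreal (measure M1 ((\<lambda>x. (x, y)) -` C)) \<partial>M2)"
    using C by (simp add: emeasure_pair_measure_alt2 M1.emeasure_eq_measure)
  also have "\<dots> = ennreal (\<integral>y. measure M1 ((\<lambda>x. (x, y)) -` C) \<partial>M2)"
    using i by (intro nn_integral_eq_integral) auto
  finally show "measure (M1 \<Otimes>\<^sub>M M2) C = (\<integral>y. measure M1 ((\<lambda>x. (x, y)) -` C) \<partial>M2)"
    by (simp add: measure_def)
qed

text \<open>Used with the training data as first coordinate: an estimate for frozen training data
  passes to the product law. The almost-everywhere form accommodates the continuity hypothesis,
  which may fail on a null set of training data.\<close>

lemma (in pair_prob_space) measure_pair_le_sections: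
  assumes "C \<in> sets (M1 \<Otimes>\<^sub>M M2)" and "AE x in M1. measure M2 (Pair x -` C) \<le> c"
  shows "measure (M1 \<Otimes>\<^sub>M M2) C \<le> c"
  using M1.integral_le_const[OF measure_pair_eq_integral_fst(1)] assms
  by (simp add: measure_pair_eq_integral_fst(2))

lemma (in pair_prob_space) measure_pair_ge_sections:
  assumes "C \<in> sets (M1 \<Otimes>\<^sub>M M2)" and "AE x in M1. c \<le> measure M2 (Pair x -` C)"
  shows "c \<le> measure (M1 \<Otimes>\<^sub>M M2) C"
  using M1.integral_ge_const[OF measure_pair_eq_integral_fst(1)] assms
  by (simp add: measure_pair_eq_integral_fst(2))

lemma prob_space_pair_measure:
  assumes "prob_space P" "prob_space Q"
  shows "prob_space (P \<Otimes>\<^sub>M Q)"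
proof -
  interpret R: pair_prob_space P Q
    using assms by (simp add: pair_prob_space_def pair_sigma_finite_def prob_space_imp_sigma_finite)
  show ?thesis by (rule R.P.prob_space_axioms)
qed

text \<open>Sections of \<open>C\<close> are events for \<open>P\<close> and \<open>P'\<close>, so
  the difference is an average over \<open>Q\<close> of quantities in \<open>[-e, e]\<close>. An
  existing error thus passes through one more independent factor without growing.\<close>

lemma measure_pair_diff_le:
  assumes "prob_space P" "prob_space P'" "prob_space Q" and PP': "sets P' = sets P"
    and e: "\<And>B. B \<in> sets P \<Longrightarrow> \<bar>measure P B - measure P' B\<bar> \<le> e"
    and C: "C \<in> sets (P \<Otimes>\<^sub>M Q)"
  shows "\<bar>measure (P \<Otimes>\<^sub>M Q) C - measure (P' \<Otimes>\<^sub>M Q) C\<bar> \<le> e"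
proof -
  interpret Q: prob_space Q by fact
  interpret A: pair_prob_space P Q
    using assms by (simp add: pair_prob_space_def pair_sigma_finite_def prob_space_imp_sigma_finite)
  interpret B: pair_prob_space P' Q
    using assms by (simp add: pair_prob_space_def pair_sigma_finite_def prob_space_imp_sigma_finite)
  have C': "C \<in> sets (P' \<Otimes>\<^sub>M Q)"
    using C PP' by (metis sets_pair_measure_cong)
  note A = A.measure_pair_eq_integral_snd[OF C] and B = B.measure_pair_eq_integral_snd[OF C']
  have e': "\<bar>measure P ((\<lambda>x. (x, y)) -` C) - measure P' ((\<lambda>x. (x, y)) -` C)\<bar> \<le> e" for y
    using C by (intro e sets_Pair2)
  then have e'': "- e \<le> measure P ((\<lambda>x. (x, y)) -` C) - measure P' ((\<lambda>x. (x, y)) -` C)" for y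
    by (metis abs_le_D2 minus_le_iff)
  have "measure (P \<Otimes>\<^sub>M Q) C - measure (P' \<Otimes>\<^sub>M Q) C =
      (\<integral>y. measure P ((\<lambda>x. (x, y)) -` C) - measure P' ((\<lambda>x. (x, y)) -` C) \<partial>Q)"
    using A B by simp
  moreover have "\<dots> \<le> e"
    using A B e' by (intro Q.integral_le_const) (auto simp: abs_le_iff)
  moreover have "- e \<le> (\<integral>y. measure P ((\<lambda>x. (x, y)) -` C) - measure P' ((\<lambda>x. (x, y)) -` C) \<partial>Q)"
    using A B e'' by (intro Q.integral_ge_const) auto
  ultimately show ?thesis by linarith
qed

text \<open>\<open>tv_dist\<close> is a supremum in the reals, so its use as an upper bound rests on
  boundedness of the family, which total mass one provides.\<close>

lemma
  assumes "prob_space P" "prob_space Q"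
  shows tv_dist_upper: "C \<in> sets P \<Longrightarrow> \<bar>measure P C - measure Q C\<bar> \<le> tv_dist P Q"
    and tv_dist_nonneg: "0 \<le> tv_dist P Q"
    and tv_dist_le_1: "tv_dist P Q \<le> 1"
proof -
  interpret P: prob_space P by fact
  interpret Q: prob_space Q by fact
  have 1: "\<bar>measure P C - measure Q C\<bar> \<le> 1" for C
    using P.prob_le_1[of C] Q.prob_le_1[of C] measure_nonneg[of P C] measure_nonneg[of Q C] by linarith
  have bdd: "bdd_above ((\<lambda>C. \<bar>measure P C - measure Q C\<bar>) ` sets P)"
    using 1 by (intro bdd_aboveI2)
  show u: "C \<in> sets P \<Longrightarrow> \<bar>measure P C - measure Q C\<bar> \<le> tv_dist P Q" for C
    unfolding tv_dist_def by (rule cSUP_upper[OF _ bdd])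
  show "0 \<le> tv_dist P Q" using u[of "{}"] by simp
  show "tv_dist P Q \<le> 1"
    unfolding tv_dist_def using 1 by (intro cSUP_least) (auto intro: sets.top)
qed

locale stationary_process = prob_space M for M :: "'a measure" +
  fixes N :: "'b measure" and Z :: "int \<Rightarrow> 'a \<Rightarrow> 'b"
  assumes Z_measurable [measurable]: "\<And>t. Z t \<in> M \<rightarrow>\<^sub>M N"
    and stationary: "stationary_proc M N Z"
begin

abbreviation \<beta> :: "nat \<Rightarrow> real" where
  "\<beta> \<equiv> beta_mix_coef M N Z"

lemma past_block_measurable [measurable]: "past_block Z \<in> M \<rightarrow>\<^sub>M Pi\<^sub>M {..0} (\<lambda>_. N)"
  unfolding past_block_def by measurable

lemma future_block_measurable [measurable]: "future_block Z a \<in> M \<rightarrow>\<^sub>M Pi\<^sub>M {int a..} (\<lambda>_. N)"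
  unfolding future_block_def by measurable

lemma prob_space_joint:
  "prob_space (distr M (Pi\<^sub>M {..0} (\<lambda>_. N) \<Otimes>\<^sub>M Pi\<^sub>M {int a..} (\<lambda>_. N)) (\<lambda>\<omega>. (past_block Z \<omega>, future_block Z a \<omega>)))"
  by (rule prob_space_distr) measurable

lemma prob_space_product:
  "prob_space (distr M (Pi\<^sub>M {..0} (\<lambda>_. N)) (past_block Z) \<Otimes>\<^sub>M distr M (Pi\<^sub>M {int a..} (\<lambda>_. N)) (future_block Z a))"
  by (intro prob_space_pair_measure prob_space_distr) measurable

lemma beta_nonneg: "0 \<le> \<beta> a" and beta_le_1: "\<beta> a \<le> 1"
  unfolding beta_mix_coef_def
  by (rule tv_dist_nonneg tv_dist_le_1, rule prob_space_joint, rule prob_space_product)+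

text \<open>Stationarity speaks of windows of consecutive times only. A finite family of times, in
  any order and with repetitions, lies in such a window, and \<open>R\<close> reads the family off
  it.\<close>

lemma distr_shift_nat:
  fixes \<tau> :: "'i \<Rightarrow> int"
  assumes J: "finite J"
  shows "distr M (Pi\<^sub>M J (\<lambda>_. N)) (\<lambda>\<omega>. \<lambda>j\<in>J. Z (\<tau> j) \<omega>) =
    distr M (Pi\<^sub>M J (\<lambda>_. N)) (\<lambda>\<omega>. \<lambda>j\<in>J. Z (\<tau> j + int k) \<omega>)"
proof -
  obtain lo where lo: "\<And>j. j \<in> J \<Longrightarrow> lo \<le> \<tau> j"
    using J bdd_below_finite[of "\<tau> ` J"] by (auto simp: bdd_below_def)
  obtain hi where hi: "\<And>j. j \<in> J \<Longrightarrow> \<tau> j \<le> hi"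
    using J bdd_above_finite[of "\<tau> ` J"] by (auto simp: bdd_above_def)
  define m where "m = nat (hi - lo)"
  define R where "R = (\<lambda>w :: nat \<Rightarrow> 'b. \<lambda>j\<in>J. w (nat (\<tau> j - lo)))"
  have idx: "nat (\<tau> j - lo) \<in> {0..m}" "Z (lo + int h + int (nat (\<tau> j - lo))) = Z (\<tau> j + int h)"
    if "j \<in> J" for j h
    using lo[OF that] hi[OF that] by (auto simp: m_def algebra_simps)
  have R[measurable]: "R \<in> Pi\<^sub>M {0..m} (\<lambda>_. N) \<rightarrow>\<^sub>M Pi\<^sub>M J (\<lambda>_. N)"
    unfolding R_def using idx(1) by (intro measurable_restrict measurable_component_singleton)
  have "distr M (Pi\<^sub>M J (\<lambda>_. N)) (\<lambda>\<omega>. \<lambda>j\<in>J. Z (\<tau> j + int h) \<omega>) =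
      distr (distr M (Pi\<^sub>M {0..m} (\<lambda>_. N)) (\<lambda>\<omega>. \<lambda>j\<in>{0..m}. Z (lo + int h + int j) \<omega>)) (Pi\<^sub>M J (\<lambda>_. N)) R" for h
    using idx by (subst distr_distr) (auto simp: R_def comp_def simp del: int_nat_eq intro!: distr_cong restrict_ext)
  from this[of 0] this[of k] show ?thesis
    using stationary unfolding stationary_proc_def by simp
qed

lemma distr_shift:
  fixes \<tau> :: "'i \<Rightarrow> int"
  assumes J: "finite J"
  shows "distr M (Pi\<^sub>M J (\<lambda>_. N)) (\<lambda>\<omega>. \<lambda>j\<in>J. Z (\<tau> j) \<omega>) =
    distr M (Pi\<^sub>M J (\<lambda>_. N)) (\<lambda>\<omega>. \<lambda>j\<in>J. Z (\<tau> j + h) \<omega>)"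
proof (cases "h \<ge> 0")
  case True
  then show ?thesis using distr_shift_nat[OF J, of \<tau> "nat h"] by simp
next
  case False
  then show ?thesis using distr_shift_nat[OF J, of "\<lambda>j. \<tau> j + h" "nat (- h)"] by simp
qed

lemma distr_fun_shift:
  fixes \<tau> :: "'i \<Rightarrow> int"
  assumes J: "finite J" and f[measurable]: "f \<in> Pi\<^sub>M J (\<lambda>_. N) \<rightarrow>\<^sub>M A"
  shows "distr M A (\<lambda>\<omega>. f (\<lambda>j\<in>J. Z (\<tau> j) \<omega>)) = distr M A (\<lambda>\<omega>. f (\<lambda>j\<in>J. Z (\<tau> j + h) \<omega>))"
proof -
  have "distr M A (\<lambda>\<omega>. f (\<lambda>j\<in>J. Z (\<sigma> j) \<omega>)) =
      distr (distr M (Pi\<^sub>M J (\<lambda>_. N)) (\<lambda>\<omega>. \<lambda>j\<in>J. Z (\<sigma> j) \<omega>)) A f" for \<sigma> :: "'i \<Rightarrow> int"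
    by (subst distr_distr) (auto simp: comp_def)
  then show ?thesis using distr_shift[OF J, of \<tau> h] by simp
qed

lemma distr_Z: "distr M N (Z t) = distr M N (Z u)"
  using distr_fun_shift[of "{()}" "\<lambda>w. w ()" N "\<lambda>_. t" "u - t"] by simp

text \<open>Stationarity moves the gap between \<open>t\<close> and \<open>t + a\<close> to the origin, where it is the
  gap in the definition of the mixing coefficient.\<close>
lemma beta_decoupling:
  fixes \<tau> :: "'i \<Rightarrow> int" and \<rho> :: "'k \<Rightarrow> int"
  assumes J: "finite J" and K: "finite K"
    and f[measurable]: "f \<in> Pi\<^sub>M J (\<lambda>_. N) \<rightarrow>\<^sub>M A" and g[measurable]: "g \<in> Pi\<^sub>M K (\<lambda>_. N) \<rightarrow>\<^sub>M B"
    and \<tau>: "\<And>j. j \<in> J \<Longrightarrow> \<tau> j \<le> t" and \<rho>: "\<And>k. k \<in> K \<Longrightarrow> t + int a \<le> \<rho> k"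
    and C[measurable]: "C \<in> sets (A \<Otimes>\<^sub>M B)"
  shows "\<bar>measure M {\<omega>\<in>space M. (f (\<lambda>j\<in>J. Z (\<tau> j) \<omega>), g (\<lambda>k\<in>K. Z (\<rho> k) \<omega>)) \<in> C} -
    measure (distr M A (\<lambda>\<omega>. f (\<lambda>j\<in>J. Z (\<tau> j) \<omega>)) \<Otimes>\<^sub>M distr M B (\<lambda>\<omega>. g (\<lambda>k\<in>K. Z (\<rho> k) \<omega>))) C\<bar> \<le> \<beta> a"
proof -
  \<comment> \<open>The disjoint sum of the index sets places both families in one vector, so that
    stationarity shifts their joint law as a whole; shifting the two marginals separately would not
    control it.\<close>
  define G where "G = (\<lambda>w. (f (\<lambda>j\<in>J. w (Inl j)), g (\<lambda>k\<in>K. w (Inr k))))"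
  have G[measurable]: "G \<in> Pi\<^sub>M (J <+> K) (\<lambda>_. N) \<rightarrow>\<^sub>M A \<Otimes>\<^sub>M B"
    unfolding G_def
    by (intro measurable_Pair measurable_compose[OF _ f] measurable_compose[OF _ g] measurable_restrict
        measurable_component_singleton) auto
  define f' where "f' = (\<lambda>p. f (\<lambda>j\<in>J. p (\<tau> j - t)))"
  define g' where "g' = (\<lambda>p. g (\<lambda>k\<in>K. p (\<rho> k - t)))"
  have [measurable]: "f' \<in> Pi\<^sub>M {..0} (\<lambda>_. N) \<rightarrow>\<^sub>M A"
    unfolding f'_def using \<tau> by (intro measurable_compose[OF _ f] measurable_restrict measurable_component_singleton) auto
  have [measurable]: "g' \<in> Pi\<^sub>M {int a..} (\<lambda>_. N) \<rightarrow>\<^sub>M B"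
    unfolding g'_def using \<rho> by (intro measurable_compose[OF _ g] measurable_restrict measurable_component_singleton) force
  have f': "f' (past_block Z \<omega>) = f (\<lambda>j\<in>J. Z (\<tau> j - t) \<omega>)" for \<omega>
    unfolding f'_def past_block_def using \<tau> by (intro arg_cong[where f=f]) (auto intro!: restrict_ext)
  have g': "g' (future_block Z a \<omega>) = g (\<lambda>k\<in>K. Z (\<rho> k - t) \<omega>)" for \<omega>
    unfolding g'_def future_block_def using \<rho> by (intro arg_cong[where f=g] restrict_ext) force
  let ?P = "distr M (Pi\<^sub>M {..0} (\<lambda>_. N)) (past_block Z)"
  let ?Q = "distr M (Pi\<^sub>M {int a..} (\<lambda>_. N)) (future_block Z a)"
  define H where "H = (\<lambda>(p, q). (f' p, g' q))"
  have [measurable]: "H \<in> Pi\<^sub>M {..0} (\<lambda>_. N) \<Otimes>\<^sub>M Pi\<^sub>M {int a..} (\<lambda>_. N) \<rightarrow>\<^sub>M A \<Otimes>\<^sub>M B"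
    unfolding H_def by measurable
  \<comment> \<open>The event is pulled back to the space of the two infinite blocks, where it is
    one of the events over which \<open>\<beta> a\<close> is a supremum.\<close>
  define C' where "C' = H -` C \<inter> space (Pi\<^sub>M {..0} (\<lambda>_. N) \<Otimes>\<^sub>M Pi\<^sub>M {int a..} (\<lambda>_. N))"
  have [measurable]: "C' \<in> sets (Pi\<^sub>M {..0} (\<lambda>_. N) \<Otimes>\<^sub>M Pi\<^sub>M {int a..} (\<lambda>_. N))"
    unfolding C'_def by measurable
  have distr_f: "distr M A (\<lambda>\<omega>. f (\<lambda>j\<in>J. Z (\<tau> j) \<omega>)) = distr ?P A f'"
    using distr_fun_shift[OF J f, of \<tau> "- t"] by (simp add: distr_distr comp_def f')
  have distr_g: "distr M B (\<lambda>\<omega>. g (\<lambda>k\<in>K. Z (\<rho> k) \<omega>)) = distr ?Q B g'"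
    using distr_fun_shift[OF K g, of \<rho> "- t"] by (simp add: distr_distr comp_def g')
  have pg: "prob_space (distr ?Q B g')"
    by (intro prob_space.prob_space_distr prob_space_distr) measurable
  have "distr ?P A f' \<Otimes>\<^sub>M distr ?Q B g' = distr (?P \<Otimes>\<^sub>M ?Q) (A \<Otimes>\<^sub>M B) H"
    unfolding H_def
    by (rule pair_measure_distr) (auto intro: prob_space_imp_sigma_finite pg)
  then have prod: "measure (distr ?P A f' \<Otimes>\<^sub>M distr ?Q B g') C = measure (?P \<Otimes>\<^sub>M ?Q) C'"
    by (simp add: measure_distr C'_def space_pair_measure)
  have "measure M {\<omega>\<in>space M. (f (\<lambda>j\<in>J. Z (\<tau> j) \<omega>), g (\<lambda>k\<in>K. Z (\<rho> k) \<omega>)) \<in> C} =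
      measure (distr M (A \<Otimes>\<^sub>M B) (\<lambda>\<omega>. G (\<lambda>j\<in>J <+> K. Z (case_sum \<tau> \<rho> j) \<omega>))) C"
    using J K by (subst measure_distr) (auto simp: G_def InlI InrI cong: restrict_cong intro!: arg_cong[where f="measure M"])
  also have "\<dots> = measure (distr M (A \<Otimes>\<^sub>M B) (\<lambda>\<omega>. G (\<lambda>j\<in>J <+> K. Z (case_sum \<tau> \<rho> j + (- t)) \<omega>))) C"
    using J K by (subst distr_fun_shift[OF _ G, where h="- t"]) auto
  also have "\<dots> = measure M {\<omega>\<in>space M. (f' (past_block Z \<omega>), g' (future_block Z a \<omega>)) \<in> C}"
    using J K unfolding f' g' by (subst measure_distr) (auto simp: G_def InlI InrI cong: restrict_cong intro!: arg_cong[where f="measure M"])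
  also have "\<dots> = measure (distr M (Pi\<^sub>M {..0} (\<lambda>_. N) \<Otimes>\<^sub>M Pi\<^sub>M {int a..} (\<lambda>_. N)) (\<lambda>\<omega>. (past_block Z \<omega>, future_block Z a \<omega>))) C'"
    using measurable_space[OF past_block_measurable] measurable_space[OF future_block_measurable, of _ a]
    by (subst measure_distr) (auto simp: C'_def H_def space_pair_measure intro!: arg_cong[where f="measure M"])
  finally show ?thesis
    unfolding distr_f distr_g prod beta_mix_coef_def
    using tv_dist_upper[OF prob_space_joint prob_space_product, of C' a] by simp
qed

end

section \<open>Deviations of empirical frequencies\<close>

lemma sum_preimage_borel:
  fixes C :: "real set"
  assumes "C \<in> sets borel"
  shows "{z. fst z + snd z \<in> C} \<in> sets (borel \<Otimes>\<^sub>M borel)"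
proof -
  have "{z. fst z + snd z \<in> C} = (\<lambda>z. fst z + snd z) -` C \<inter> space (borel \<Otimes>\<^sub>M borel :: (real \<times> real) measure)"
    by (auto simp: space_pair_measure)
  then show ?thesis using assms by simp
qed

context stationary_process
begin

lemma distr_block:
  fixes g :: "(nat \<Rightarrow> 'b) \<Rightarrow> real"
  assumes g: "g \<in> Pi\<^sub>M {..<a} (\<lambda>_. N) \<rightarrow>\<^sub>M borel"
  shows "distr M borel (\<lambda>\<omega>. g (\<lambda>j\<in>{..<a}. Z (t + int j) \<omega>)) =
    distr M borel (\<lambda>\<omega>. g (\<lambda>j\<in>{..<a}. Z (u + int j) \<omega>))"
  using distr_fun_shift[OF _ g, of "\<lambda>j. t + int j" "u - t"] by (simp add: algebra_simps)

text \<open>Induction on the number of blocks. The sum of those already treated is a function of the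
  past and the next block lies beyond an omitted block of length \<open>a\<close>, so replacing it
  by an independent one costs \<open>\<beta> a\<close>; \<open>measure_pair_diff_le\<close> carries
  the previous error along. Between \<open>k + 1\<close> blocks there are \<open>k\<close> gaps,
  hence the factor \<open>k\<close>.\<close>

lemma block_sum_near_convolution_power:
  fixes g :: "(nat \<Rightarrow> 'b) \<Rightarrow> real"
  assumes g[measurable]: "g \<in> Pi\<^sub>M {..<a} (\<lambda>_. N) \<rightarrow>\<^sub>M borel"
    and \<mu>: "\<mu> = distr M borel (\<lambda>\<omega>. g (\<lambda>j\<in>{..<a}. Z (t + int j) \<omega>))"
    and C: "C \<in> sets borel"
  shows "\<bar>measure M {\<omega>\<in>space M. (\<Sum>i\<le>k. g (\<lambda>j\<in>{..<a}. Z (t + int (2 * i * a + j)) \<omega>)) \<in> C} -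
    measure (convolution_power \<mu> (Suc k)) C\<bar> \<le> real k * \<beta> a"
  using C
proof (induction k arbitrary: C)
  case 0
  interpret \<mu>: prob_space \<mu> unfolding \<mu> by (rule prob_space_distr) measurable
  have [measurable_cong]: "sets \<mu> = sets borel" by (simp add: \<mu>)
  interpret R: pair_prob_space "return borel 0 :: real measure" \<mu>
    by (simp add: pair_prob_space_def pair_sigma_finite_def prob_space_imp_sigma_finite prob_space_return
        \<mu>.prob_space_axioms)
  note [measurable] = 0
  define E where "E = (\<lambda>(x, y). x + y) -` C \<inter> space ((return borel 0 :: real measure) \<Otimes>\<^sub>M \<mu>)"
  have "sets ((return borel 0 :: real measure) \<Otimes>\<^sub>M \<mu>) = sets (borel \<Otimes>\<^sub>M borel)"
    by (intro sets_pair_measure_cong) (auto simp: \<mu>)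
  then have meas: "(\<lambda>(x, y). x + y) \<in> (return borel 0 :: real measure) \<Otimes>\<^sub>M \<mu> \<rightarrow>\<^sub>M borel"
    by (subst measurable_cong_sets[OF _ refl, where M' = "borel \<Otimes>\<^sub>M borel"]) measurable
  then have E: "E \<in> sets ((return borel 0 :: real measure) \<Otimes>\<^sub>M \<mu>)"
    unfolding E_def using 0 by (rule measurable_sets)
  \<comment> \<open>Convolution with the unit mass at 0 changes nothing: a single block has law
    \<open>\<mu>\<close> exactly and costs no mixing term.\<close>
  have "measure (convolution_power \<mu> (Suc 0)) C = measure ((return borel 0 :: real measure) \<Otimes>\<^sub>M \<mu>) E"
    unfolding E_def convolution_power.simps using 0 by (subst measure_distr) (auto simp: meas)
  also have "\<dots> = measure \<mu> (Pair 0 -` E)"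
    unfolding R.measure_pair_eq_integral_fst(2)[OF E]
    using borel_measurable_integrable[OF R.measure_pair_eq_integral_fst(1)[OF E]]
    by (intro integral_return) auto
  also have "Pair 0 -` E = C"
    by (auto simp: E_def space_pair_measure \<mu>)
  finally have "measure (convolution_power \<mu> (Suc 0)) C = measure \<mu> C" .
  moreover have "measure \<mu> C = measure M {\<omega>\<in>space M. g (\<lambda>j\<in>{..<a}. Z (t + int j) \<omega>) \<in> C}"
    unfolding \<mu> using 0 by (subst measure_distr) (auto intro!: arg_cong[where f="measure M"])
  moreover have "(\<Sum>i\<le>(0 :: nat). h i) = h 0" for h :: "nat \<Rightarrow> real" by simp
  ultimately show ?case by (simp only: mult_zero_right mult_zero_left add_0 diff_self abs_zero of_nat_0)
next
  case (Suc k)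
  note [measurable] = Suc.prems
  define Y where "Y = (\<lambda>i \<omega>. g (\<lambda>j\<in>{..<a}. Z (t + int (2 * i * a + j)) \<omega>))"
  have Y[measurable]: "Y i \<in> borel_measurable M" for i unfolding Y_def by measurable
  define T where "T = (\<lambda>\<omega>. \<Sum>i\<le>k. Y i \<omega>)"
  have T[measurable]: "T \<in> borel_measurable M" unfolding T_def by measurable
  have p\<mu>: "prob_space \<mu>" unfolding \<mu> by (rule prob_space_distr) measurable
  have [measurable_cong]: "sets \<mu> = sets borel" by (simp add: \<mu>)
  have Yg: "g (\<lambda>j\<in>{..<a}. Z (t + int (2 * Suc k * a + j)) \<omega>) = Y (Suc k) \<omega>" for \<omega>
    by (simp only: Y_def)
  have Y\<mu>: "distr M borel (Y (Suc k)) = \<mu>"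
    unfolding Y_def \<mu> using distr_block[OF g, of "t + int (2 * Suc k * a)" t] by (simp add: algebra_simps)
  define J where "J = {..k} \<times> {..<a}"
  define f where "f = (\<lambda>w. \<Sum>i\<le>k. g (\<lambda>j\<in>{..<a}. w (i, j)))"
  have f: "f \<in> Pi\<^sub>M J (\<lambda>_. N) \<rightarrow>\<^sub>M borel"
    unfolding f_def J_def
    by (intro borel_measurable_sum measurable_compose[OF _ g] measurable_restrict measurable_component_singleton) auto
  define \<tau> where "\<tau> = (\<lambda>(i, j). t + int (2 * i * a + j))"
  have fT: "f (\<lambda>x\<in>J. Z (\<tau> x) \<omega>) = T \<omega>" for \<omega>
    unfolding f_def T_def Y_def J_def \<tau>_def
    by (intro sum.cong refl arg_cong[where f=g] restrict_ext) auto
  define D where "D = {z. fst z + snd z \<in> C}"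
  have D[measurable]: "D \<in> sets (borel \<Otimes>\<^sub>M borel)"
    unfolding D_def by (rule sum_preimage_borel[OF Suc.prems])
  have "\<bar>measure M {\<omega>\<in>space M. (f (\<lambda>x\<in>J. Z (\<tau> x) \<omega>), g (\<lambda>j\<in>{..<a}. Z (t + int (2 * Suc k * a + j)) \<omega>)) \<in> D} -
    measure (distr M borel (\<lambda>\<omega>. f (\<lambda>x\<in>J. Z (\<tau> x) \<omega>)) \<Otimes>\<^sub>M
             distr M borel (\<lambda>\<omega>. g (\<lambda>j\<in>{..<a}. Z (t + int (2 * Suc k * a + j)) \<omega>))) D\<bar> \<le> \<beta> a"
  \<comment> \<open>Every index used so far is below \<open>2 * k * a + a\<close>, and the next
    block starts at \<open>2 * (k + 1) * a\<close>, which is \<open>a\<close> later.\<close>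
  proof (rule beta_decoupling[OF _ _ f g, where t = "t + int (2 * k * a + a)"])
    fix x assume "x \<in> J"
    then obtain i j where x: "x = (i, j)" "i \<le> k" "j < a" by (auto simp: J_def)
    then have "i * a \<le> k * a" by simp
    with x have "2 * i * a + j \<le> 2 * k * a + a" unfolding mult.assoc by linarith
    with x show "\<tau> x \<le> t + int (2 * k * a + a)" by (simp only: \<tau>_def split_conv add_le_cancel_left of_nat_le_iff)
  qed (auto simp: J_def algebra_simps)
  then have 1: "\<bar>measure M {\<omega>\<in>space M. (T \<omega>, Y (Suc k) \<omega>) \<in> D} -
      measure (distr M borel T \<Otimes>\<^sub>M \<mu>) D\<bar> \<le> \<beta> a"
    unfolding fT Yg Y\<mu> .
  have 2: "\<bar>measure (distr M borel T \<Otimes>\<^sub>M \<mu>) D - measure (convolution_power \<mu> (Suc k) \<Otimes>\<^sub>M \<mu>) D\<bar> \<le> real k * \<beta> a"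
  proof (rule measure_pair_diff_le)
    show "\<bar>measure (distr M borel T) B - measure (convolution_power \<mu> (Suc k)) B\<bar> \<le> real k * \<beta> a"
      if "B \<in> sets (distr M borel T)" for B
    proof -
      have B: "B \<in> sets borel" using that by simp
      have "(\<Sum>i\<le>k. g (\<lambda>j\<in>{..<a}. Z (t + int (2 * i * a + j)) \<omega>)) = T \<omega>" for \<omega>
        by (simp only: T_def Y_def)
      moreover have "measure (distr M borel T) B = measure M {\<omega>\<in>space M. T \<omega> \<in> B}"
        using B by (subst measure_distr) (auto intro!: arg_cong[where f="measure M"])
      ultimately show ?thesis using Suc.IH[OF B] by (simp only:)
    qed
    show "D \<in> sets (distr M borel T \<Otimes>\<^sub>M \<mu>)"
      using D by (simp cong: sets_pair_measure_cong)
  qed (auto intro!: p\<mu> prob_space_distr prob_space_convolution_power simp: \<mu> simp del: convolution_power.simps)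
  have "(\<lambda>(x, y). x + y) -` C \<inter> space (convolution_power \<mu> (Suc k) \<Otimes>\<^sub>M \<mu>) = D"
    by (auto simp: D_def space_pair_measure \<mu>)
  then have 3: "measure (convolution_power \<mu> (Suc (Suc k))) C = measure (convolution_power \<mu> (Suc k) \<Otimes>\<^sub>M \<mu>) D"
    unfolding convolution_power.simps(2)[of \<mu> "Suc k"]
    by (subst measure_distr) (auto simp del: convolution_power.simps)
  have "(\<Sum>i\<le>Suc k. g (\<lambda>j\<in>{..<a}. Z (t + int (2 * i * a + j)) \<omega>)) = T \<omega> + Y (Suc k) \<omega>" for \<omega>
    by (simp add: T_def Y_def)
  then have 4: "{\<omega>\<in>space M. (\<Sum>i\<le>Suc k. g (\<lambda>j\<in>{..<a}. Z (t + int (2 * i * a + j)) \<omega>)) \<in> C} =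
      {\<omega>\<in>space M. (T \<omega>, Y (Suc k) \<omega>) \<in> D}"
    by (simp add: D_def)
  show ?case unfolding 3 4 using 1 2 by (simp add: algebra_simps)
qed

section \<open>Moments of visit counts to a fixed set\<close>

definition visits :: "'b set \<Rightarrow> int \<Rightarrow> 'a \<Rightarrow> real" where
  "visits B t \<omega> = indicator B (Z t \<omega>)"

abbreviation law :: "'b set \<Rightarrow> real" where
  "law B \<equiv> measure (distr M N (Z 1)) B"

lemma visits_measurable [measurable]:
  assumes [measurable]: "B \<in> sets N"
  shows "visits B t \<in> borel_measurable M"
  unfolding visits_def by measurable

lemma law_eq:
  assumes "B \<in> sets N"
  shows "law B = measure M {\<omega>\<in>space M. Z t \<omega> \<in> B}"
  unfolding distr_Z[of 1 t] using assms
  by (subst measure_distr) (auto intro!: arg_cong[where f="measure M"])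

lemma law_bounds: "0 \<le> law B" "law B \<le> 1"
proof -
  interpret L: prob_space "distr M N (Z 1)" by (rule prob_space_distr) measurable
  show "0 \<le> law B" "law B \<le> 1" by simp_all
qed

lemma integrable_visits:
  assumes [measurable]: "B \<in> sets N"
  shows "integrable M (visits B t)" "integrable M (\<lambda>\<omega>. visits B t \<omega> * visits B u \<omega>)"
  by (rule integrable_const_bound[where B=1]; auto simp: visits_def indicator_def)+

lemma expectation_visits:
  assumes [measurable]: "B \<in> sets N"
  shows "expectation (visits B t) = law B"
proof -
  have "expectation (visits B t) = expectation (indicator {\<omega>\<in>space M. Z t \<omega> \<in> B})"
    by (intro Bochner_Integration.integral_cong) (auto simp: visits_def indicator_def)
  then show ?thesis using law_eq[of B t] by simp
qed

text \<open>For indicators the covariance is the difference between the joint law and the product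
  law on the rectangle \<open>B \<times> B\<close>, so the mixing coefficient at that lag bounds it
  with constant 1.\<close>

lemma covariance_visits_le:
  assumes [measurable]: "B \<in> sets N" and st: "s < t"
  shows "expectation (\<lambda>\<omega>. (visits B s \<omega> - law B) * (visits B t \<omega> - law B)) \<le> \<beta> (nat (t - s))"
proof -
  interpret L: prob_space "distr M N (Z 1)" by (rule prob_space_distr) measurable
  note I = integrable_visits[of B]
  have "expectation (\<lambda>\<omega>. (visits B s \<omega> - law B) * (visits B t \<omega> - law B)) =
      expectation (\<lambda>\<omega>. visits B s \<omega> * visits B t \<omega> - law B * visits B s \<omega> - law B * visits B t \<omega> + (law B)\<^sup>2)"
    by (simp add: algebra_simps power2_eq_square)
  also have "\<dots> = expectation (\<lambda>\<omega>. visits B s \<omega> * visits B t \<omega>) - (law B)\<^sup>2"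
    using I by (simp add: expectation_visits prob_space power2_eq_square)
  also have "expectation (\<lambda>\<omega>. visits B s \<omega> * visits B t \<omega>) =
      expectation (indicator {\<omega>\<in>space M. (Z s \<omega>, Z t \<omega>) \<in> B \<times> B})"
    by (intro Bochner_Integration.integral_cong) (auto simp: visits_def indicator_def)
  also have "\<dots> = measure M {\<omega>\<in>space M. (Z s \<omega>, Z t \<omega>) \<in> B \<times> B}"
    by simp
  also have "(law B)\<^sup>2 = measure (distr M N (Z s) \<Otimes>\<^sub>M distr M N (Z t)) (B \<times> B)"
    unfolding distr_Z[of s 1] distr_Z[of t 1]
    by (simp add: measure_def L.emeasure_pair_measure_Times enn2real_mult power2_eq_square)
  finally show ?thesis
    using beta_decoupling[of "{()}" "{()}" "\<lambda>w. w ()" N "\<lambda>w. w ()" N "\<lambda>_. s" s "nat (t - s)" "\<lambda>_. t" "B \<times> B"] st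
    by (simp add: abs_le_iff)
qed

text \<open>An indicator equals its square, so its variance is \<open>p * (1 - p)\<close> with
  \<open>p = law B\<close>. This is the \<open>1/4\<close> in \<open>sigma_tilde\<close>.\<close>

lemma variance_visits_le:
  assumes [measurable]: "B \<in> sets N"
  shows "expectation (\<lambda>\<omega>. (visits B t \<omega> - law B)\<^sup>2) \<le> 1 / 4"
proof -
  note I = integrable_visits[of B]
  have "expectation (\<lambda>\<omega>. (visits B t \<omega> - law B)\<^sup>2) =
      expectation (\<lambda>\<omega>. visits B t \<omega> - 2 * law B * visits B t \<omega> + (law B)\<^sup>2)"
    by (intro Bochner_Integration.integral_cong) (auto simp: visits_def indicator_def power2_eq_square algebra_simps)
  also have "\<dots> = law B - (law B)\<^sup>2"
    using I by (simp add: expectation_visits prob_space power2_eq_square)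
  also have "\<dots> \<le> 1 / 4"
    using zero_le_power2[of "law B - 1 / 2"] by (simp add: power2_eq_square algebra_simps)
  finally show ?thesis .
qed

text \<open>Passing from \<open>a\<close> to \<open>a + 1\<close> terms adds one variance and twice
  the covariances with all earlier terms, at lags 1 to \<open>a\<close>; this raises the weight of
  each \<open>\<beta> j\<close> from \<open>a - j\<close> to \<open>a + 1 - j\<close>. The
  right-hand side is \<open>a\<close> times the square of
  \<open>sigma_tilde \<beta> a\<close>.\<close>

lemma variance_block_le:
  assumes B[measurable]: "B \<in> sets N"
  shows "expectation (\<lambda>\<omega>. (\<Sum>j<a. visits B (t + int j) \<omega> - law B)\<^sup>2) \<le>
    real a / 4 + 2 * (\<Sum>j=1..a - 1. (real a - real j) * \<beta> j)"
proof (induction a)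
  case (Suc a)
  let ?c = "\<lambda>j \<omega>. visits B (t + int j) \<omega> - law B"
  have bd: "\<bar>?c j \<omega>\<bar> \<le> 1" for j \<omega>
    using law_bounds[of B] by (auto simp: visits_def indicator_def)
  have i2: "integrable M (\<lambda>\<omega>. ?c i \<omega> * ?c j \<omega>)" for i j
    using bd[of i] bd[of j] by (intro integrable_const_bound[where B=1]) (auto simp: abs_mult intro!: mult_le_one)
  have iS: "integrable M (\<lambda>\<omega>. (\<Sum>j<a. ?c j \<omega>)\<^sup>2)"
    unfolding power2_eq_square sum_product using i2 by auto
  have "expectation (\<lambda>\<omega>. (\<Sum>j<Suc a. ?c j \<omega>)\<^sup>2) =
      expectation (\<lambda>\<omega>. (\<Sum>j<a. ?c j \<omega>)\<^sup>2 + 2 * (\<Sum>j<a. ?c j \<omega> * ?c a \<omega>) + (?c a \<omega>)\<^sup>2)"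
    unfolding sum.lessThan_Suc power2_sum sum_distrib_right[symmetric] by (simp add: algebra_simps)
  also have "\<dots> = expectation (\<lambda>\<omega>. (\<Sum>j<a. ?c j \<omega>)\<^sup>2) +
      2 * (\<Sum>j<a. expectation (\<lambda>\<omega>. ?c j \<omega> * ?c a \<omega>)) + expectation (\<lambda>\<omega>. (?c a \<omega>)\<^sup>2)"
    using iS i2 i2[of a a] by (simp add: power2_eq_square)
  also have "\<dots> \<le> (real a / 4 + 2 * (\<Sum>j=1..a - 1. (real a - real j) * \<beta> j)) +
      2 * (\<Sum>j<a. \<beta> (a - j)) + 1 / 4"
  proof (intro add_mono Suc mult_left_mono sum_mono variance_visits_le[OF B])
    fix j assume "j \<in> {..<a}"
    moreover have "nat (t + int a - (t + int j)) = a - j" by simp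
    ultimately show "expectation (\<lambda>\<omega>. ?c j \<omega> * ?c a \<omega>) \<le> \<beta> (a - j)"
      using covariance_visits_le[OF B, of "t + int j" "t + int a"] by simp
  qed simp
  also have "(\<Sum>j<a. \<beta> (a - j)) = (\<Sum>j=1..a. \<beta> j)"
    by (rule sum.reindex_bij_witness[where i="\<lambda>j. a - j" and j="\<lambda>j. a - j"]) auto
  also have "(\<Sum>j=1..a - 1. (real a - real j) * \<beta> j) = (\<Sum>j=1..a. (real a - real j) * \<beta> j)"
    by (cases a) auto
  finally have *: "expectation (\<lambda>\<omega>. (\<Sum>j<Suc a. ?c j \<omega>)\<^sup>2) \<le> real a / 4 +
      2 * (\<Sum>j=1..a. (real a - real j) * \<beta> j) + 2 * (\<Sum>j=1..a. \<beta> j) + 1 / 4" .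
  have "(\<Sum>j=1..a. (real (Suc a) - real j) * \<beta> j) = (\<Sum>j=1..a. (real a - real j) * \<beta> j) + (\<Sum>j=1..a. \<beta> j)"
    unfolding sum.distrib[symmetric] by (intro sum.cong) (auto simp: algebra_simps)
  then show ?case using * by (simp add: add_divide_distrib)
qed simp

end

section \<open>Tail bounds for alternating blocks\<close>

lemma sum_lessThan_add:
  fixes f :: "nat \<Rightarrow> 'a :: comm_monoid_add"
  shows "sum f {..<x + y} = sum f {..<x} + (\<Sum>j<y. f (x + j))"
  by (induction y) (auto simp: add.assoc)

text \<open>The second family of blocks repeats the pattern of the first, started \<open>a\<close>
  later, so one tail bound with a free starting time serves both.\<close>

lemma sum_alternating_blocks:
  fixes f :: "nat \<Rightarrow> 'a :: comm_monoid_add"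
  shows "sum f {..<2 * m * a} =
    (\<Sum>i<m. \<Sum>j<a. f (2 * i * a + j)) + (\<Sum>i<m. \<Sum>j<a. f (a + (2 * i * a + j)))"
proof (induction m)
  case (Suc m)
  have "sum f {..<2 * Suc m * a} = sum f {..<2 * m * a + a + a}"
    by (simp add: algebra_simps)
  also have "\<dots> = sum f {..<2 * m * a} + (\<Sum>j<a. f (2 * m * a + j)) + (\<Sum>j<a. f (2 * m * a + a + j))"
    by (simp only: sum_lessThan_add)
  finally show ?case unfolding Suc by (simp add: algebra_simps)
qed simp

context stationary_process
begin

lemma sigma_tilde_pos: "0 < sigma_tilde \<beta> a"
proof -
  have "0 \<le> (\<Sum>j=1..a - 1. (real a - real j) * \<beta> j)"
    by (intro sum_nonneg mult_nonneg_nonneg beta_nonneg) auto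
  then show ?thesis
    by (auto simp: sigma_tilde_def intro!: add_pos_nonneg)
qed

text \<open>The Bernstein radius for the mean of \<open>m\<close> independent block averages whose
  variance is at most the square of \<open>sigma_tilde \<beta> a\<close> divided by
  \<open>a\<close>. With \<open>2 * m * a = n_cal - r + 1\<close> and \<open>L\<close> the logarithm
  in \<open>eps_cal\<close>, it is the sum of the first two terms there.\<close>

definition deviation :: "nat \<Rightarrow> nat \<Rightarrow> real \<Rightarrow> real" where
  "deviation a m L = sigma_tilde \<beta> a * sqrt (2 * L / (real m * real a)) + L / (3 * real m)"

lemma deviation_nonneg: "0 \<le> L \<Longrightarrow> 0 \<le> deviation a m L"
  using sigma_tilde_pos[of a] by (simp add: deviation_def)

lemma alternate_blocks_tail:
  assumes B[measurable]: "B \<in> sets N" and L: "L \<ge> 0" and m: "m > 0" and a: "a > 0"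
  shows "measure M {\<omega>\<in>space M. real (m * a) * (law B + deviation a m L) \<le>
      (\<Sum>i<m. \<Sum>j<a. visits B (t + int (2 * i * a + j)) \<omega>)} \<le> (real m - 1) * \<beta> a + exp (- L)"
proof -
  obtain k where k: "m = Suc k" using m by (cases m) auto
  \<comment> \<open>Each block enters through its centred average, which has absolute value at most
    1 whatever \<open>a\<close> is; so a block counts as one bounded variable, and the linear
    Bernstein term has denominator \<open>3 * m\<close>.\<close>
  define g where "g = (\<lambda>w :: nat \<Rightarrow> 'b. (\<Sum>j<a. indicator B (w j)) / real a - law B)"
  have g[measurable]: "g \<in> Pi\<^sub>M {..<a} (\<lambda>_. N) \<rightarrow>\<^sub>M borel"
    unfolding g_def by measurable
  define X where "X = (\<lambda>\<omega>. g (\<lambda>j\<in>{..<a}. Z (t + int j) \<omega>))"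
  have X[measurable]: "X \<in> borel_measurable M" unfolding X_def by measurable
  define \<mu> where "\<mu> = distr M borel X"
  have p\<mu>: "prob_space \<mu>" unfolding \<mu>_def by (rule prob_space_distr) measurable
  have gX: "g (\<lambda>j\<in>{..<a}. Z (u + int j) \<omega>) = (\<Sum>j<a. visits B (u + int j) \<omega> - law B) / real a" for u \<omega>
    unfolding g_def visits_def using a by (simp add: sum_subtractf diff_divide_distrib)
  have bd: "\<bar>X \<omega>\<bar> \<le> 1" for \<omega>
  proof -
    have "\<bar>\<Sum>j<a. visits B (t + int j) \<omega> - law B\<bar> \<le> (\<Sum>j<a. \<bar>visits B (t + int j) \<omega> - law B\<bar>)"
      by (rule sum_abs)
    also have "\<dots> \<le> (\<Sum>j<a. 1)"
      using law_bounds[of B] by (intro sum_mono) (auto simp: visits_def indicator_def)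
    finally show ?thesis unfolding X_def gX using a by (simp add: divide_simps)
  qed
  have mean: "expectation X = 0"
    unfolding X_def gX using integrable_visits(1)[OF B]
    by (simp add: expectation_visits[OF B] prob_space)
  have "expectation (\<lambda>\<omega>. (X \<omega>)\<^sup>2) = expectation (\<lambda>\<omega>. (\<Sum>j<a. visits B (t + int j) \<omega> - law B)\<^sup>2) / (real a)\<^sup>2"
    unfolding X_def gX by (simp add: power_divide)
  also have "\<dots> \<le> (real a / 4 + 2 * (\<Sum>j=1..a - 1. (real a - real j) * \<beta> j)) / (real a)\<^sup>2"
    by (intro divide_right_mono variance_block_le[OF B]) auto
  also have "\<dots> = (sigma_tilde \<beta> a)\<^sup>2 / real a"
  proof -
    have "(sigma_tilde \<beta> a)\<^sup>2 = 1 / 4 + 2 / real a * (\<Sum>j=1..a - 1. (real a - real j) * \<beta> j)"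
      using sigma_tilde_pos[of a] by (simp add: sigma_tilde_def)
    then show ?thesis using a by (simp add: power2_eq_square field_simps)
  qed
  finally have var: "expectation (\<lambda>\<omega>. (X \<omega>)\<^sup>2) \<le> (sigma_tilde \<beta> a)\<^sup>2 / real a" .
  have dev: "deviation a m L = sqrt (2 * ((sigma_tilde \<beta> a)\<^sup>2 / real a) * L / real m) + L / (3 * real m)"
  proof -
    have "2 * ((sigma_tilde \<beta> a)\<^sup>2 / real a) * L / real m = (sigma_tilde \<beta> a)\<^sup>2 * (2 * L / (real m * real a))"
      by (simp add: mult_ac)
    then show ?thesis
      using sigma_tilde_pos[of a] by (simp only: deviation_def real_sqrt_mult) simp
  qed
  have "AE x in \<mu>. \<bar>x\<bar> \<le> 1"
    unfolding \<mu>_def by (subst AE_distr_iff) (use bd in auto)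
  then have "measure (convolution_power \<mu> m) {x. x \<ge> real m *
      (sqrt (2 * ((sigma_tilde \<beta> a)\<^sup>2 / real a) * L / real m) + L / real (3 * m))} \<le> exp (- L)"
    using bd mean var sigma_tilde_pos[of a] m a L
    by (intro convolution_power_sub_gamma_tail p\<mu>) (auto simp: \<mu>_def integral_distr)
  then have tail: "measure (convolution_power \<mu> m) {x. x \<ge> real m * deviation a m L} \<le> exp (- L)"
    unfolding dev by simp
  have "\<bar>measure M {\<omega>\<in>space M. (\<Sum>i\<le>k. g (\<lambda>j\<in>{..<a}. Z (t + int (2 * i * a + j)) \<omega>)) \<in> {x. x \<ge> real m * deviation a m L}} -
    measure (convolution_power \<mu> (Suc k)) {x. x \<ge> real m * deviation a m L}\<bar> \<le> real k * \<beta> a"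
    by (rule block_sum_near_convolution_power[OF g, where t = t]) (auto simp: \<mu>_def X_def)
  then have "measure M {\<omega>\<in>space M. (\<Sum>i\<le>k. g (\<lambda>j\<in>{..<a}. Z (t + int (2 * i * a + j)) \<omega>)) \<ge> real m * deviation a m L} \<le>
      (real m - 1) * \<beta> a + exp (- L)"
    using tail unfolding k by simp
  moreover have "(\<Sum>i\<le>k. g (\<lambda>j\<in>{..<a}. Z (t + int (2 * i * a + j)) \<omega>)) \<ge> real m * deviation a m L \<longleftrightarrow>
      real (m * a) * (law B + deviation a m L) \<le> (\<Sum>i<m. \<Sum>j<a. visits B (t + int (2 * i * a + j)) \<omega>)" for \<omega>
  proof -
    have "(\<Sum>i\<le>k. g (\<lambda>j\<in>{..<a}. Z (t + int (2 * i * a + j)) \<omega>)) =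
        (\<Sum>i<m. (\<Sum>j<a. visits B (t + int (2 * i * a + j)) \<omega>) / real a - law B)"
      unfolding k lessThan_Suc_atMost g_def visits_def by simp
    also have "\<dots> = (\<Sum>i<m. \<Sum>j<a. visits B (t + int (2 * i * a + j)) \<omega>) / real a - real m * law B"
      by (simp add: sum_subtractf sum_divide_distrib)
    finally show ?thesis using a by (simp only:) (simp add: field_simps)
  qed
  ultimately show ?thesis by simp
qed

text \<open>If the mean over all \<open>2 * m * a\<close> points is too large, it is too large over
  one of the two interleaved families. The union bound asks nothing about their dependence and
  produces the factor 2.\<close>

lemma empirical_tail:
  assumes B[measurable]: "B \<in> sets N" and L: "L \<ge> 0" and m: "m > 0" and a: "a > 0"
  shows "measure M {\<omega>\<in>space M. real (2 * m * a) * (law B + deviation a m L) \<le>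
      (\<Sum>j<2 * m * a. visits B (t + int j) \<omega>)} \<le> 2 * ((real m - 1) * \<beta> a + exp (- L))"
proof -
  let ?S = "\<lambda>t. {\<omega>\<in>space M. real (m * a) * (law B + deviation a m L) \<le>
      (\<Sum>i<m. \<Sum>j<a. visits B (t + int (2 * i * a + j)) \<omega>)}"
  have [measurable]: "?S u \<in> sets M" for u by measurable
  have "{\<omega>\<in>space M. real (2 * m * a) * (law B + deviation a m L) \<le> (\<Sum>j<2 * m * a. visits B (t + int j) \<omega>)} \<subseteq>
      ?S t \<union> ?S (t + int a)"
    unfolding sum_alternating_blocks[of _ m a] by (auto simp: algebra_simps)
  then have "measure M {\<omega>\<in>space M. real (2 * m * a) * (law B + deviation a m L) \<le>
      (\<Sum>j<2 * m * a. visits B (t + int j) \<omega>)} \<le> measure M (?S t \<union> ?S (t + int a))"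
    by (intro finite_measure_mono) auto
  also have "\<dots> \<le> measure M (?S t) + measure M (?S (t + int a))"
    by (intro measure_Un_le) auto
  also have "\<dots> \<le> ((real m - 1) * \<beta> a + exp (- L)) + ((real m - 1) * \<beta> a + exp (- L))"
    by (intro add_mono alternate_blocks_tail[OF assms])
  finally show ?thesis by simp
qed

section \<open>Visits to sets chosen by the training data\<close>

definition training_data :: "nat \<Rightarrow> 'a \<Rightarrow> nat \<Rightarrow> 'b" where
  "training_data k \<omega> = (\<lambda>j\<in>{1..k}. Z (int j) \<omega>)"

lemma training_data_measurable [measurable]:
  "training_data k \<in> M \<rightarrow>\<^sub>M Pi\<^sub>M {1..k} (\<lambda>_. N)"
  unfolding training_data_def by measurable

text \<open>The set visited depends on the training data, so \<open>empirical_tail\<close> does not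
  apply under the joint law. Under the product law the data can be frozen at \<open>d\<close>, and
  the section of \<open>E\<close> at \<open>d\<close> is a fixed set. The dropped points may all be
  visits, which accounts for the summand \<open>r - 1\<close> in the event.\<close>

lemma calibration_tail:
  fixes n_train n_cal a m r :: nat and c L :: real
  assumes E[measurable]: "E \<in> sets (Pi\<^sub>M {1..n_train} (\<lambda>_. N) \<Otimes>\<^sub>M N)"
    and c: "\<And>d. d \<in> space (Pi\<^sub>M {1..n_train} (\<lambda>_. N)) \<Longrightarrow> law (Pair d -` E) \<le> c"
    and c0: "0 \<le> c"
    and L: "L \<ge> 0" and m: "m > 0" and a: "a > 0" and r: "r > 0"
    and cal: "n_cal = 2 * m * a + (r - 1)"
  shows "measure M {\<omega>\<in>space M. real n_cal * (c + deviation a m L) + real (r - 1) \<le>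
      (\<Sum>j\<in>{n_train + 1..n_train + n_cal}. indicator E (training_data n_train \<omega>, Z (int j) \<omega>))} \<le>
    \<beta> r + 2 * ((real m - 1) * \<beta> a + exp (- L))"
proof -
  let ?PD = "Pi\<^sub>M {1..n_train} (\<lambda>_. N)"
  let ?PK = "Pi\<^sub>M {..<2 * m * a} (\<lambda>_. N)"
  \<comment> \<open>The retained stretch starts at \<open>n_train + r\<close>, exactly
    \<open>r\<close> after the last training time.\<close>
  define V where "V = (\<lambda>\<omega>. \<lambda>k\<in>{..<2 * m * a}. Z (int (n_train + r) + int k) \<omega>)"
  have V[measurable]: "V \<in> M \<rightarrow>\<^sub>M ?PK" unfolding V_def by measurable
  define C where "C = {x\<in>space (?PD \<Otimes>\<^sub>M ?PK). real (2 * m * a) * (c + deviation a m L) \<le>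
      (\<Sum>k<2 * m * a. indicator E (fst x, snd x k))}"
  have C[measurable]: "C \<in> sets (?PD \<Otimes>\<^sub>M ?PK)"
    unfolding C_def by measurable
  interpret D: prob_space "distr M ?PD (training_data n_train)" by (rule prob_space_distr) measurable
  interpret V: prob_space "distr M ?PK V" by (rule prob_space_distr) measurable
  interpret DV: pair_prob_space "distr M ?PD (training_data n_train)" "distr M ?PK V" ..
  have "measure (distr M ?PD (training_data n_train) \<Otimes>\<^sub>M distr M ?PK V) C \<le> 2 * ((real m - 1) * \<beta> a + exp (- L))"
  proof (rule DV.measure_pair_le_sections)
    show "AE d in distr M ?PD (training_data n_train).
        measure (distr M ?PK V) (Pair d -` C) \<le> 2 * ((real m - 1) * \<beta> a + exp (- L))"
    proof (rule AE_I2)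
      fix d assume "d \<in> space (distr M ?PD (training_data n_train))"
      then have d: "d \<in> space ?PD" by simp
      have Ed[measurable]: "Pair d -` E \<in> sets N" by (rule sets_Pair1[OF E])
      have "measure (distr M ?PK V) (Pair d -` C) = measure M (V -` (Pair d -` C) \<inter> space M)"
        by (intro measure_distr V sets_Pair1[OF C])
      also have "\<dots> \<le> measure M {\<omega>\<in>space M. real (2 * m * a) * (law (Pair d -` E) + deviation a m L) \<le>
          (\<Sum>j<2 * m * a. visits (Pair d -` E) (int (n_train + r) + int j) \<omega>)}"
      proof (intro finite_measure_mono subsetI)
        fix \<omega> assume \<omega>: "\<omega> \<in> V -` (Pair d -` C) \<inter> space M"
        have "real (2 * m * a) * (law (Pair d -` E) + deviation a m L) \<le> real (2 * m * a) * (c + deviation a m L)"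
          using c[OF d] by (intro mult_left_mono) auto
        also have "\<dots> \<le> (\<Sum>k<2 * m * a. indicator E (d, V \<omega> k))"
          using \<omega> by (simp add: C_def)
        also have "\<dots> = (\<Sum>j<2 * m * a. visits (Pair d -` E) (int (n_train + r) + int j) \<omega>)"
          by (intro sum.cong) (auto simp: V_def visits_def indicator_def)
        finally show "\<omega> \<in> {\<omega>\<in>space M. real (2 * m * a) * (law (Pair d -` E) + deviation a m L) \<le>
          (\<Sum>j<2 * m * a. visits (Pair d -` E) (int (n_train + r) + int j) \<omega>)}"
          using \<omega> by simp
      qed measurable
      also have "\<dots> \<le> 2 * ((real m - 1) * \<beta> a + exp (- L))"
        by (rule empirical_tail[OF Ed L m a])
      finally show "measure (distr M ?PK V) (Pair d -` C) \<le> 2 * ((real m - 1) * \<beta> a + exp (- L))" .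
    qed
  qed measurable
  moreover have "\<bar>measure M {\<omega>\<in>space M. (training_data n_train \<omega>, V \<omega>) \<in> C} -
      measure (distr M ?PD (training_data n_train) \<Otimes>\<^sub>M distr M ?PK V) C\<bar> \<le> \<beta> r"
    using beta_decoupling[of "{1..n_train}" "{..<2 * m * a}" "\<lambda>w. w" ?PD "\<lambda>w. w" ?PK int "int n_train" r
        "\<lambda>k. int (n_train + r) + int k" C] C
    unfolding V_def training_data_def[abs_def] by simp
  moreover have "measure M {\<omega>\<in>space M. real n_cal * (c + deviation a m L) + real (r - 1) \<le>
      (\<Sum>j\<in>{n_train + 1..n_train + n_cal}. indicator E (training_data n_train \<omega>, Z (int j) \<omega>))} \<le>
      measure M {\<omega>\<in>space M. (training_data n_train \<omega>, V \<omega>) \<in> C}"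
  proof (intro finite_measure_mono subsetI)
    let ?f = "\<lambda>\<omega> j. indicator E (training_data n_train \<omega>, Z (int j) \<omega>) :: real"
    fix \<omega> assume "\<omega> \<in> {\<omega>\<in>space M. real n_cal * (c + deviation a m L) + real (r - 1) \<le>
      (\<Sum>j\<in>{n_train + 1..n_train + n_cal}. ?f \<omega> j)}"
    then have \<omega>: "\<omega> \<in> space M" and
      *: "real n_cal * (c + deviation a m L) + real (r - 1) \<le> (\<Sum>j\<in>{n_train + 1..n_train + n_cal}. ?f \<omega> j)" by auto
    have "{n_train + 1..n_train + n_cal} = {n_train + 1..<n_train + r} \<union> {n_train + r..<n_train + r + 2 * m * a}"
      using r cal by auto
    then have "(\<Sum>j\<in>{n_train + 1..n_train + n_cal}. ?f \<omega> j) =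
        (\<Sum>j\<in>{n_train + 1..<n_train + r}. ?f \<omega> j) + (\<Sum>j\<in>{n_train + r..<n_train + r + 2 * m * a}. ?f \<omega> j)"
      by (simp only:) (intro sum.union_disjoint; auto)
    moreover have "(\<Sum>j\<in>{n_train + 1..<n_train + r}. ?f \<omega> j) \<le> (\<Sum>j\<in>{n_train + 1..<n_train + r}. 1)"
      by (intro sum_mono) (auto simp: indicator_def)
    moreover have "(\<Sum>j\<in>{n_train + r..<n_train + r + 2 * m * a}. ?f \<omega> j) =
        (\<Sum>k<2 * m * a. indicator E (training_data n_train \<omega>, V \<omega> k))"
      by (rule sum.reindex_bij_witness[where j="\<lambda>j. j - (n_train + r)" and i="\<lambda>k. n_train + r + k"])
        (auto simp: V_def)
    ultimately have "real n_cal * (c + deviation a m L) \<le> (\<Sum>k<2 * m * a. indicator E (training_data n_train \<omega>, V \<omega> k))"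
      using * by simp
    \<comment> \<open>Replacing \<open>n_cal\<close> by the smaller \<open>2 * m * a\<close> is
      sound because the other factor is nonnegative; this is where \<open>0 \<le> c\<close>
      enters.\<close>
    moreover have "real (2 * m * a) * (c + deviation a m L) \<le> real n_cal * (c + deviation a m L)"
      using c0 deviation_nonneg[OF L, of a m] cal by (intro mult_right_mono) auto
    ultimately show "\<omega> \<in> {\<omega>\<in>space M. (training_data n_train \<omega>, V \<omega>) \<in> C}"
      using \<omega> measurable_space[OF V \<omega>] measurable_space[OF training_data_measurable \<omega>]
      by (simp add: C_def space_pair_measure)
  qed measurable
  ultimately show ?thesis by linarith
qed

end

section \<open>Quantiles and coverage\<close>

text \<open>The generalised inverse of the distribution function. As an infimum in the reals it is
  meaningful only for levels strictly between 0 and 1, which is why other levels are treated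
  apart.\<close>

definition quantile :: "real measure \<Rightarrow> real \<Rightarrow> real" where
  "quantile \<mu> c = Inf {x. c \<le> cdf \<mu> x}"

text \<open>A possible atom at the quantile is counted in the closed half-line and left out of the
  open one, so both inequalities hold for every distribution. The second comes from the left limit
  of the distribution function.\<close>

lemma (in real_distribution)
  assumes c: "0 < c" "c < 1"
  shows quantile_le_iff: "quantile M c \<le> x \<longleftrightarrow> c \<le> cdf M x"
    and measure_atMost_quantile: "c \<le> measure M {..quantile M c}"
    and measure_lessThan_quantile: "measure M {..<quantile M c} \<le> c"
proof -
  interpret cdf_distribution M by unfold_locales
  show q: "quantile M c \<le> x \<longleftrightarrow> c \<le> cdf M x" for x
    unfolding quantile_def by (rule pseudoinverse[OF c, symmetric])
  show "c \<le> measure M {..quantile M c}"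
    using q[of "quantile M c"] by (simp add: cdf_def2)
  show "measure M {..<quantile M c} \<le> c"
  proof (rule tendsto_upperbound[OF cdf_at_left])
    have "cdf M x \<le> c" if "x < quantile M c" for x
      using q[of x] that by linarith
    then show "eventually (\<lambda>x. cdf M x \<le> c) (at_left (quantile M c))"
      by (auto simp: eventually_at_filter intro!: always_eventually)
  qed simp
qed

text \<open>By \<open>quantile_le_iff\<close>, a sublevel set of the quantile is a superlevel set of
  the measure of a section, which is measurable in \<open>d\<close>. This makes sets bounded by a
  data-dependent quantile measurable in the product space.\<close>

lemma measurable_quantile:
  assumes "prob_space \<mu>" and s[measurable]: "(\<lambda>(d, z). s d z) \<in> A \<Otimes>\<^sub>M \<mu> \<rightarrow>\<^sub>M (borel :: real measure)"
    and c: "0 < c" "c < 1"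
  shows "(\<lambda>d. quantile (distr \<mu> borel (s d)) c) \<in> borel_measurable A"
proof (rule borel_measurableI_le)
  fix x
  interpret \<mu>: prob_space \<mu> by fact
  define H where "H = {y\<in>space (A \<Otimes>\<^sub>M \<mu>). (\<lambda>(d, z). s d z) y \<le> x}"
  have [measurable]: "H \<in> sets (A \<Otimes>\<^sub>M \<mu>)" unfolding H_def by measurable
  have sd[measurable]: "s d \<in> borel_measurable \<mu>" if "d \<in> space A" for d
    using measurable_compose[OF measurable_Pair1'[OF that] s] by simp
  have "cdf (distr \<mu> borel (s d)) x = measure \<mu> (Pair d -` H)" if "d \<in> space A" for d
    using that sd[OF that] unfolding cdf_def2
    by (subst measure_distr) (auto simp: H_def space_pair_measure intro!: arg_cong[where f="measure \<mu>"])
  then have "{d\<in>space A. quantile (distr \<mu> borel (s d)) c \<le> x} = {d\<in>space A. c \<le> measure \<mu> (Pair d -` H)}"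
    using c real_distribution.quantile_le_iff[OF \<mu>.real_distribution_distr[OF sd]] by auto
  also have "\<dots> \<in> sets A"
    using \<mu>.measurable_emeasure_Pair[of H A] unfolding measure_def by measurable
  finally show "{d\<in>space A. quantile (distr \<mu> borel (s d)) c \<le> x} \<in> sets A" .
qed

text \<open>The empirical quantile is at least \<open>x\<close> unless some threshold below
  \<open>x\<close> already captures the share \<open>\<phi>\<close>. Counting strictly smaller
  scores removes the infimum, handles ties, and turns coverage into a statement on finite
  sums.\<close>

lemma le_cal_quantile_iff:
  assumes I: "finite I" "I \<noteq> {}" and \<phi>: "\<phi> > 0"
  shows "ereal x \<le> cal_quantile \<phi> I S \<longleftrightarrow> real (card {i\<in>I. S i < x}) < \<phi> * real (card I)"
proof -
  have cI: "real (card I) > 0" using I by (simp add: card_gt_0_iff)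
  have "ereal x \<le> cal_quantile \<phi> I S \<longleftrightarrow> (\<forall>t. \<phi> * real (card I) \<le> real (card {i\<in>I. S i \<le> t}) \<longrightarrow> x \<le> t)"
    unfolding cal_quantile_def le_Inf_iff using cI by (auto simp: pos_le_divide_eq)
  also have "\<dots> \<longleftrightarrow> real (card {i\<in>I. S i < x}) < \<phi> * real (card I)"
  proof (intro iffI allI impI)
    assume *: "\<forall>t. \<phi> * real (card I) \<le> real (card {i\<in>I. S i \<le> t}) \<longrightarrow> x \<le> t"
    show "real (card {i\<in>I. S i < x}) < \<phi> * real (card I)"
    proof (rule ccontr)
      assume "\<not> real (card {i\<in>I. S i < x}) < \<phi> * real (card I)"
      then have ge: "\<phi> * real (card I) \<le> real (card {i\<in>I. S i < x})" by simp
      \<comment> \<open>The largest score below \<open>x\<close> is a threshold strictly below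
        \<open>x\<close> that captures all these scores. Such a score exists because
        \<open>ge\<close> and \<open>\<phi> > 0\<close> make the count positive.\<close>
      define t where "t = Max (S ` {i\<in>I. S i < x})"
      have "0 < \<phi> * real (card I)" using \<phi> cI by simp
      with ge have "card {i\<in>I. S i < x} > 0" by linarith
      then have ne: "{i\<in>I. S i < x} \<noteq> {}" by (metis card.empty less_irrefl)
      then have "t \<in> S ` {i\<in>I. S i < x}" unfolding t_def using I by (intro Max_in) auto
      then have "t < x" by auto
      moreover have "{i\<in>I. S i < x} \<subseteq> {i\<in>I. S i \<le> t}" unfolding t_def using I by (auto intro!: Max_ge)
      then have "card {i\<in>I. S i < x} \<le> card {i\<in>I. S i \<le> t}" using I by (intro card_mono) auto
      then have "\<phi> * real (card I) \<le> real (card {i\<in>I. S i \<le> t})" using ge by linarith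
      then have "x \<le> t" using * by blast
      ultimately show False by linarith
    qed
  next
    fix t assume *: "real (card {i\<in>I. S i < x}) < \<phi> * real (card I)" "\<phi> * real (card I) \<le> real (card {i\<in>I. S i \<le> t})"
    show "x \<le> t"
    proof (rule ccontr)
      assume "\<not> x \<le> t"
      then have "card {i\<in>I. S i \<le> t} \<le> card {i\<in>I. S i < x}" using I by (intro card_mono) auto
      with * show False by linarith
    qed
  qed
  finally show ?thesis .
qed

section \<open>Coverage compared with a quantile given the training data\<close>

context stationary_process
begin

lemma test_decoupling:
  assumes T[measurable]: "T \<in> sets (Pi\<^sub>M {1..n_train} (\<lambda>_. N) \<Otimes>\<^sub>M N)" and i: "n_train \<le> i"
  shows "\<bar>measure M {\<omega>\<in>space M. (training_data n_train \<omega>, Z (int i) \<omega>) \<in> T} -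
    measure (distr M (Pi\<^sub>M {1..n_train} (\<lambda>_. N)) (training_data n_train) \<Otimes>\<^sub>M distr M N (Z 1)) T\<bar> \<le> \<beta> (i - n_train)"
proof -
  show ?thesis
    using beta_decoupling[of "{1..n_train}" "{()}" "\<lambda>w. w" "Pi\<^sub>M {1..n_train} (\<lambda>_. N)" "\<lambda>w. w ()" N int "int n_train" "i - n_train"
        "\<lambda>_. int i" T] T i
    unfolding training_data_def[abs_def] distr_Z[of 1 "int i"] by simp
qed

context
  fixes n_train n_cal i a m r :: nat and \<alpha> L :: real and s :: "(nat \<Rightarrow> 'b) \<Rightarrow> 'b \<Rightarrow> real"
  assumes s_measurable [measurable]: "(\<lambda>(d, z). s d z) \<in> (Pi\<^sub>M {1..n_train} (\<lambda>_. N) \<Otimes>\<^sub>M N) \<rightarrow>\<^sub>M borel"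
    and i: "n_train \<le> i" and L: "L \<ge> 0" and m: "m > 0" and a: "a > 0" and r: "r > 0"
    and cal: "n_cal = 2 * m * a + (r - 1)" and \<alpha>: "0 < \<alpha>" "\<alpha> < 1"
begin

definition score_law :: "(nat \<Rightarrow> 'b) \<Rightarrow> real measure" where
  "score_law d = distr (distr M N (Z 1)) borel (s d)"

definition score :: "nat \<Rightarrow> 'a \<Rightarrow> real" where
  "score j \<omega> = s (training_data n_train \<omega>) (Z (int j) \<omega>)"

definition covered :: "'a set" where
  "covered = {\<omega>\<in>space M. ereal (score i \<omega>) \<le>
    cal_quantile (1 - \<alpha>) {n_train + 1..n_train + n_cal} (\<lambda>j. score j \<omega>)}"

definition slack :: real where
  "slack = deviation a m L + real (r - 1) / real n_cal"

definition failure :: real where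
  "failure = \<beta> r + 2 * ((real m - 1) * \<beta> a + exp (- L))"

lemma slack_nonneg: "0 \<le> slack"
  using deviation_nonneg[OF L] by (simp add: slack_def)

lemma score_measurable [measurable]: "score j \<in> borel_measurable M"
  using measurable_compose[OF measurable_Pair[OF training_data_measurable Z_measurable] s_measurable]
  by (simp add: score_def[abs_def])

lemma score_section_measurable:
  assumes "d \<in> space (Pi\<^sub>M {1..n_train} (\<lambda>_. N))"
  shows "s d \<in> borel_measurable N"
  using measurable_compose[OF measurable_Pair1'[OF assms] s_measurable] by simp

lemma real_distribution_score_law:
  assumes "d \<in> space (Pi\<^sub>M {1..n_train} (\<lambda>_. N))"
  shows "real_distribution (score_law d)"
proof -
  interpret Q: prob_space "distr M N (Z 1)" by (rule prob_space_distr) measurable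
  show ?thesis
    unfolding score_law_def using score_section_measurable[OF assms]
    by (intro Q.real_distribution_distr) simp
qed

lemma measurable_score_quantile:
  assumes "0 < c" "c < 1"
  shows "(\<lambda>d. quantile (score_law d) c) \<in> borel_measurable (Pi\<^sub>M {1..n_train} (\<lambda>_. N))"
  unfolding score_law_def
proof (rule measurable_quantile)
  show "prob_space (distr M N (Z 1))" by (rule prob_space_distr) measurable
  show "(\<lambda>(d, z). s d z) \<in> Pi\<^sub>M {1..n_train} (\<lambda>_. N) \<Otimes>\<^sub>M distr M N (Z 1) \<rightarrow>\<^sub>M borel"
    using s_measurable by (simp cong: measurable_cong_sets del: One_nat_def)
qed fact+

lemma law_score_section:
  assumes d: "d \<in> space (Pi\<^sub>M {1..n_train} (\<lambda>_. N))" and A: "A \<in> sets borel"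
    and E: "\<And>z. z \<in> space N \<Longrightarrow> (d, z) \<in> E \<longleftrightarrow> s d z \<in> A"
    and E_sets: "E \<in> sets (Pi\<^sub>M {1..n_train} (\<lambda>_. N) \<Otimes>\<^sub>M N)"
  shows "law (Pair d -` E) = measure (score_law d) A"
proof -
  have "(d, z) \<in> E \<Longrightarrow> z \<in> space N" for z
    using sets.sets_into_space[OF E_sets] by (auto simp: space_pair_measure)
  then have "Pair d -` E = s d -` A \<inter> space N" using E by auto
  then show ?thesis
    unfolding score_law_def using A score_section_measurable[OF d] by (subst measure_distr) auto
qed

lemma n_cal_pos: "0 < n_cal"
  using cal m a by simp

lemma covered_eq: "covered = {\<omega>\<in>space M.
    real (card {j\<in>{n_train + 1..n_train + n_cal}. score j \<omega> < score i \<omega>}) < (1 - \<alpha>) * real n_cal}"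
  unfolding covered_def using \<alpha> n_cal_pos by (subst le_cal_quantile_iff) auto

lemma covered_measurable [measurable]: "covered \<in> sets M"
proof -
  have "real (card {j\<in>{n_train + 1..n_train + n_cal}. score j \<omega> < score i \<omega>}) =
    (\<Sum>j\<in>{n_train + 1..n_train + n_cal}. if score j \<omega> < score i \<omega> then 1 else 0)" for \<omega>
    by (subst sum.inter_filter[symmetric]) auto
  then show ?thesis unfolding covered_eq by simp
qed

text \<open>\<open>Q d\<close> is taken at a level lowered by \<open>slack\<close>. Outside an event
  of probability at most \<open>failure\<close>, fewer than \<open>(1 - \<alpha>) * n_cal\<close>
  calibration scores lie strictly below \<open>Q d\<close>, so every test score up to
  \<open>Q d\<close> is covered; under the product law such scores have probability at least
  \<open>c\<close>.\<close>

lemma coverage_lower: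
  assumes c: "0 < 1 - \<alpha> - slack"
  shows "1 - \<alpha> - slack - \<beta> (i - n_train) - failure \<le> measure M covered"
proof -
  let ?PD = "Pi\<^sub>M {1..n_train} (\<lambda>_. N)"
  define c where "c = 1 - \<alpha> - slack"
  have c01: "0 < c" "c < 1" using c \<alpha> slack_nonneg by (auto simp: c_def)
  define Q where "Q = (\<lambda>d. quantile (score_law d) c)"
  have Q[measurable]: "Q \<in> borel_measurable ?PD" unfolding Q_def by (rule measurable_score_quantile[OF c01])
  note quant = real_distribution.measure_atMost_quantile[OF real_distribution_score_law c01]
    real_distribution.measure_lessThan_quantile[OF real_distribution_score_law c01]
  define E where "E = {x\<in>space (?PD \<Otimes>\<^sub>M N). (\<lambda>(d, z). s d z) x < Q (fst x)}"
  define T where "T = {x\<in>space (?PD \<Otimes>\<^sub>M N). (\<lambda>(d, z). s d z) x \<le> Q (fst x)}"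
  have E[measurable]: "E \<in> sets (?PD \<Otimes>\<^sub>M N)" unfolding E_def by measurable
  have T[measurable]: "T \<in> sets (?PD \<Otimes>\<^sub>M N)" unfolding T_def by measurable
  have lawE: "law (Pair d -` E) \<le> c" if d: "d \<in> space ?PD" for d
    using quant(2)[OF d] law_score_section[OF d _ _ E, of "{..<Q d}"] d
    by (auto simp: E_def Q_def space_pair_measure)
  have lawT: "c \<le> law (Pair d -` T)" if d: "d \<in> space ?PD" for d
    using quant(1)[OF d] law_score_section[OF d _ _ T, of "{..Q d}"] d
    by (auto simp: T_def Q_def space_pair_measure)
  interpret D: prob_space "distr M ?PD (training_data n_train)" by (rule prob_space_distr) measurable
  interpret V: prob_space "distr M N (Z 1)" by (rule prob_space_distr) measurable
  interpret DV: pair_prob_space "distr M ?PD (training_data n_train)" "distr M N (Z 1)" ..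
  have "c \<le> measure (distr M ?PD (training_data n_train) \<Otimes>\<^sub>M distr M N (Z 1)) T"
    using lawT T by (intro DV.measure_pair_ge_sections AE_I2) (auto simp del: One_nat_def)
  then have test: "c - \<beta> (i - n_train) \<le> measure M {\<omega>\<in>space M. (training_data n_train \<omega>, Z (int i) \<omega>) \<in> T}"
    using test_decoupling[OF T i] by linarith
  define bad where "bad = {\<omega>\<in>space M. real n_cal * (c + deviation a m L) + real (r - 1) \<le>
      (\<Sum>j\<in>{n_train + 1..n_train + n_cal}. indicator E (training_data n_train \<omega>, Z (int j) \<omega>))}"
  have bad[measurable]: "bad \<in> sets M" unfolding bad_def by measurable
  have pbad: "measure M bad \<le> failure"
    unfolding bad_def failure_def by (rule calibration_tail[OF E lawE _ L m a r cal]) (use c01 in auto)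
  have "real n_cal > 0" using n_cal_pos by simp
  \<comment> \<open>The level was lowered by exactly the amount that turns the threshold of
    \<open>bad\<close> into the count in \<open>covered_eq\<close>.\<close>
  then have ncc: "real n_cal * (c + deviation a m L) + real (r - 1) = (1 - \<alpha>) * real n_cal"
    by (simp add: c_def slack_def field_simps)
  have "{\<omega>\<in>space M. (training_data n_train \<omega>, Z (int i) \<omega>) \<in> T} \<subseteq> covered \<union> bad"
  proof safe
    fix \<omega> assume \<omega>: "\<omega> \<in> space M" "(training_data n_train \<omega>, Z (int i) \<omega>) \<in> T" "\<omega> \<notin> bad"
    let ?I = "{n_train + 1..n_train + n_cal}"
    have "real (card {j\<in>?I. score j \<omega> < score i \<omega>}) = (\<Sum>j\<in>?I. if score j \<omega> < score i \<omega> then 1 else 0)"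
      by (subst sum.inter_filter[symmetric]) auto
    also have "\<dots> \<le> (\<Sum>j\<in>?I. indicator E (training_data n_train \<omega>, Z (int j) \<omega>))"
      using \<omega>(1,2) measurable_space[OF Z_measurable \<omega>(1)] measurable_space[OF training_data_measurable \<omega>(1)]
      by (intro sum_mono) (auto simp: E_def T_def score_def space_pair_measure indicator_def)
    also have "\<dots> < (1 - \<alpha>) * real n_cal" using \<omega>(1,3) ncc by (simp add: bad_def not_le)
    finally show "\<omega> \<in> covered" using \<omega>(1) by (simp add: covered_eq)
  qed
  then have "measure M {\<omega>\<in>space M. (training_data n_train \<omega>, Z (int i) \<omega>) \<in> T} \<le> measure M (covered \<union> bad)"
    by (intro finite_measure_mono) auto
  also have "\<dots> \<le> measure M covered + measure M bad" by (intro measure_Un_le) auto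
  finally show ?thesis using test pbad by (simp add: c_def)
qed

text \<open>The mirror argument, with the level raised by \<open>slack\<close> and the calibration
  scores above \<open>Q d\<close> counted: a covered test score beyond \<open>Q d\<close> forces too
  many of them. Continuity enters in \<open>lawT\<close>, where it bounds the closed half-line up to
  \<open>Q d\<close>, possible atom included, by the level.\<close>

lemma coverage_upper:
  assumes c: "1 - \<alpha> + slack < 1"
    and cont: "AE d in distr M (Pi\<^sub>M {1..n_train} (\<lambda>_. N)) (training_data n_train). \<forall>t. measure (score_law d) {t} = 0"
  shows "measure M covered \<le> 1 - \<alpha> + slack + \<beta> (i - n_train) + failure"
proof -
  let ?PD = "Pi\<^sub>M {1..n_train} (\<lambda>_. N)"
  define c where "c = 1 - \<alpha> + slack"
  have c01: "0 < c" "c < 1" using c \<alpha> slack_nonneg by (auto simp: c_def)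
  define Q where "Q = (\<lambda>d. quantile (score_law d) c)"
  have Q[measurable]: "Q \<in> borel_measurable ?PD" unfolding Q_def by (rule measurable_score_quantile[OF c01])
  note quant = real_distribution.measure_atMost_quantile[OF real_distribution_score_law c01]
    real_distribution.measure_lessThan_quantile[OF real_distribution_score_law c01]
  define E where "E = {x\<in>space (?PD \<Otimes>\<^sub>M N). Q (fst x) < (\<lambda>(d, z). s d z) x}"
  define T where "T = {x\<in>space (?PD \<Otimes>\<^sub>M N). (\<lambda>(d, z). s d z) x \<le> Q (fst x)}"
  have E[measurable]: "E \<in> sets (?PD \<Otimes>\<^sub>M N)" unfolding E_def by measurable
  have T[measurable]: "T \<in> sets (?PD \<Otimes>\<^sub>M N)" unfolding T_def by measurable
  have lawE: "law (Pair d -` E) \<le> 1 - c" if d: "d \<in> space ?PD" for d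
  proof -
    interpret R: real_distribution "score_law d" by (rule real_distribution_score_law[OF d])
    have "measure (score_law d) {Q d<..} = 1 - measure (score_law d) {..Q d}"
      using R.prob_compl[of "{..Q d}"] by (simp add: Compl_eq_Diff_UNIV[symmetric])
    then show ?thesis
      using quant(1)[OF d] law_score_section[OF d _ _ E, of "{Q d<..}"] d
      by (auto simp: E_def Q_def space_pair_measure)
  qed
  have lawT: "law (Pair d -` T) \<le> c" if d: "d \<in> space ?PD" and 0: "\<forall>t. measure (score_law d) {t} = 0" for d
  proof -
    interpret R: real_distribution "score_law d" by (rule real_distribution_score_law[OF d])
    have "measure (score_law d) {..Q d} \<le> measure (score_law d) {..<Q d} + measure (score_law d) {Q d}"
      unfolding ivl_disj_un_singleton(2)[symmetric] by (intro measure_Un_le) auto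
    also have "\<dots> \<le> c" using quant(2)[OF d] 0 by (simp add: Q_def)
    finally show ?thesis
      using law_score_section[OF d _ _ T, of "{..Q d}"] d by (auto simp: T_def space_pair_measure)
  qed
  interpret D: prob_space "distr M ?PD (training_data n_train)" by (rule prob_space_distr) measurable
  interpret V: prob_space "distr M N (Z 1)" by (rule prob_space_distr) measurable
  interpret DV: pair_prob_space "distr M ?PD (training_data n_train)" "distr M N (Z 1)" ..
  have "AE d in distr M ?PD (training_data n_train). law (Pair d -` T) \<le> c"
    using cont AE_space by eventually_elim (rule lawT, simp_all)
  then have "measure (distr M ?PD (training_data n_train) \<Otimes>\<^sub>M distr M N (Z 1)) T \<le> c"
    using T by (intro DV.measure_pair_le_sections) (auto simp del: One_nat_def)
  then have test: "measure M {\<omega>\<in>space M. (training_data n_train \<omega>, Z (int i) \<omega>) \<in> T} \<le> c + \<beta> (i - n_train)"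
    using test_decoupling[OF T i] by linarith
  define bad where "bad = {\<omega>\<in>space M. real n_cal * ((1 - c) + deviation a m L) + real (r - 1) \<le>
      (\<Sum>j\<in>{n_train + 1..n_train + n_cal}. indicator E (training_data n_train \<omega>, Z (int j) \<omega>))}"
  have bad[measurable]: "bad \<in> sets M" unfolding bad_def by measurable
  have pbad: "measure M bad \<le> failure"
    unfolding bad_def failure_def by (rule calibration_tail[OF E lawE _ L m a r cal]) (use c01 in auto)
  have "real n_cal > 0" using n_cal_pos by simp
  then have ncc: "real n_cal * ((1 - c) + deviation a m L) + real (r - 1) = \<alpha> * real n_cal"
    by (simp add: c_def slack_def field_simps)
  have "covered \<subseteq> {\<omega>\<in>space M. (training_data n_train \<omega>, Z (int i) \<omega>) \<in> T} \<union> bad"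
  proof safe
    fix \<omega> assume cov: "\<omega> \<in> covered" and nb: "\<omega> \<notin> bad"
    then show \<omega>: "\<omega> \<in> space M" by (simp add: covered_eq)
    let ?I = "{n_train + 1..n_train + n_cal}" and ?d = "training_data n_train \<omega>"
    note sp = measurable_space[OF Z_measurable \<omega>] measurable_space[OF training_data_measurable \<omega>]
    show "(?d, Z (int i) \<omega>) \<in> T"
    proof (rule ccontr)
      assume "(?d, Z (int i) \<omega>) \<notin> T"
      then have gt: "Q ?d < score i \<omega>"
        using sp by (auto simp: T_def score_def space_pair_measure)
      have "real n_cal = (\<Sum>j\<in>?I. 1)" by simp
      \<comment> \<open>As the test score exceeds \<open>Q d\<close>, every calibration score is
        below the test score or above \<open>Q d\<close>, possibly both.\<close>
      also have "\<dots> \<le> (\<Sum>j\<in>?I. (if score j \<omega> < score i \<omega> then 1 else 0) + indicator E (?d, Z (int j) \<omega>))"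
        using gt sp by (intro sum_mono) (auto simp: E_def score_def space_pair_measure indicator_def)
      also have "\<dots> = real (card {j\<in>?I. score j \<omega> < score i \<omega>}) + (\<Sum>j\<in>?I. indicator E (?d, Z (int j) \<omega>))"
        unfolding sum.distrib by (subst sum.inter_filter[symmetric]) auto
      also have "\<dots> < (1 - \<alpha>) * real n_cal + \<alpha> * real n_cal"
        using cov nb \<omega> ncc by (intro add_strict_mono) (auto simp: covered_eq bad_def not_le)
      finally show False by (simp add: algebra_simps)
    qed
  qed
  then have "measure M covered \<le> measure M ({\<omega>\<in>space M. (training_data n_train \<omega>, Z (int i) \<omega>) \<in> T} \<union> bad)"
    by (intro finite_measure_mono) auto
  also have "\<dots> \<le> measure M {\<omega>\<in>space M. (training_data n_train \<omega>, Z (int i) \<omega>) \<in> T} + measure M bad"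
    by (intro measure_Un_le) auto
  finally show ?thesis using test pbad by (simp add: c_def)
qed

end

end

section \<open>The parameters in \<open>F_cal\<close> and the infimum over them\<close>

definition cal_term :: "(nat \<Rightarrow> real) \<Rightarrow> nat \<Rightarrow> real \<Rightarrow> nat \<Rightarrow> nat \<Rightarrow> nat \<Rightarrow> real" where
  "cal_term \<beta> n_cal \<delta> a m r =
    sigma_tilde \<beta> a * sqrt (4 / (real n_cal - real r + 1) * ln (4 / (\<delta> - 4 * (real m - 1) * \<beta> a - \<beta> r)))
      + 1 / (3 * real m) * ln (4 / (\<delta> - 4 * (real m - 1) * \<beta> a - \<beta> r)) + (real r - 1) / real n_cal"

context stationary_process
begin

text \<open>A crude bound from \<open>\<beta> j \<le> 1\<close>; it serves the regime in which the
  logarithm is negative.\<close>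

lemma sigma_tilde_power2_le:
  assumes a: "a > 0"
  shows "(sigma_tilde \<beta> a)\<^sup>2 \<le> 2 * real a"
proof -
  have "(\<Sum>j=1..a - 1. (real a - real j) * \<beta> j) \<le> (\<Sum>j=1..a - 1. real a * 1)"
    using beta_nonneg beta_le_1 by (intro sum_mono mult_mono) auto
  then have "2 / real a * (\<Sum>j=1..a - 1. (real a - real j) * \<beta> j) \<le> 2 / real a * (real (a - 1) * real a)"
    by (intro mult_left_mono) auto
  also have "\<dots> = 2 * (real a - 1)" using a by (simp add: of_nat_diff)
  moreover have "(sigma_tilde \<beta> a)\<^sup>2 = 1 / 4 + 2 / real a * (\<Sum>j=1..a - 1. (real a - real j) * \<beta> j)"
    using sigma_tilde_pos[of a] by (simp add: sigma_tilde_def)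
  ultimately show ?thesis by simp
qed

text \<open>In this case the logarithm in \<open>cal_term\<close> is negative, and the error bound is vacuous
  because the coefficients are at most \<open>1\<close>.\<close>
lemma cal_term_trivial:
  assumes a: "a > 0" and m: "m > 0" and r: "r > 0"
    and cal: "n_cal = 2 * m * a + (r - 1)"
    and \<kappa>: "\<delta> - 4 * (real m - 1) * \<beta> a - \<beta> r > 4"
  shows "1 \<le> cal_term \<beta> n_cal \<delta> a m r + \<delta>"
proof -
  define x where "x = (\<delta> - 4 * (real m - 1) * \<beta> a - \<beta> r) / 4"
  have x: "x > 1" using \<kappa> by (simp add: x_def)
  have \<delta>: "\<delta> \<ge> 4 * x"
  proof -
    define y where "y = 4 * (real m - 1) * \<beta> a"
    have "0 \<le> y" unfolding y_def using m beta_nonneg[of a] by (intro mult_nonneg_nonneg) auto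
    then show ?thesis using beta_nonneg[of r] unfolding x_def y_def[symmetric] by simp
  qed
  have ln: "ln (4 / (\<delta> - 4 * (real m - 1) * \<beta> a - \<beta> r)) = - ln x"
    using x by (simp add: x_def ln_div)
  have lx: "0 \<le> ln x" "ln x \<le> x - 1" using x by (auto intro: ln_le_minus_one)
  have nc: "real n_cal - real r + 1 = 2 * real m * real a" using r by (simp add: cal of_nat_diff)
  have "sigma_tilde \<beta> a * sqrt (4 / (2 * real m * real a) * ln x) = sqrt ((sigma_tilde \<beta> a)\<^sup>2 * (4 / (2 * real m * real a) * ln x))"
    using sigma_tilde_pos[of a] by (simp only: real_sqrt_mult) simp
  \<comment> \<open>The inequality \<open>4 * y \<le> (1 + y)^2\<close> trades the square root for a
    term linear in \<open>ln x\<close>; with \<open>ln x \<le> x - 1\<close> it is then outweighed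
    by \<open>\<delta> \<ge> 4 * x\<close>.\<close>
  also have "\<dots> \<le> sqrt ((1 + ln x)\<^sup>2)"
  proof (rule real_sqrt_le_mono)
    have "(sigma_tilde \<beta> a)\<^sup>2 * (4 / (2 * real m * real a) * ln x) \<le> 2 * real a * (4 / (2 * real m * real a) * ln x)"
      using lx by (intro mult_right_mono sigma_tilde_power2_le a) auto
    also have "\<dots> = 4 / real m * ln x" using a by simp
    also have "\<dots> \<le> 4 * ln x" using m lx by (intro mult_right_mono) (auto simp: divide_le_eq)
    also have "\<dots> \<le> (1 + ln x)\<^sup>2"
      using zero_le_power2[of "1 - ln x"] by (simp add: power2_eq_square algebra_simps)
    finally show "(sigma_tilde \<beta> a)\<^sup>2 * (4 / (2 * real m * real a) * ln x) \<le> (1 + ln x)\<^sup>2" .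
  qed
  also have "\<dots> = 1 + ln x" using lx by simp
  finally have 1: "sigma_tilde \<beta> a * sqrt (4 / (2 * real m * real a) * ln x) \<le> 1 + ln x" .
  have 2: "1 / (3 * real m) * ln x \<le> 1 / 3 * ln x"
    using m lx by (intro mult_right_mono) (auto simp: divide_le_eq)
  have 3: "0 \<le> (real r - 1) / real n_cal" using r by auto
  \<comment> \<open>The real \<open>sqrt\<close> of HOL is an odd function, so a negative radicand
    makes the first term negative rather than undefined.\<close>
  have "cal_term \<beta> n_cal \<delta> a m r = - (sigma_tilde \<beta> a * sqrt (4 / (2 * real m * real a) * ln x))
      - 1 / (3 * real m) * ln x + (real r - 1) / real n_cal"
    unfolding cal_term_def ln nc by (simp add: real_sqrt_minus)
  then show ?thesis using 1 2 3 \<delta> lx x by linarith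
qed

text \<open>Three regimes for a fixed triple. For \<open>\<kappa> > 4\<close> the logarithm is
  negative and \<open>cal_term_trivial\<close> applies. If the shifted level leaves the open unit
  interval, the bound is vacuous because \<open>P\<close> lies in \<open>[0, 1]\<close>. Otherwise
  the quantile comparison applies.\<close>

lemma coverage:
  fixes n_train n_cal i a m r :: nat and \<alpha> \<delta> :: real and s :: "(nat \<Rightarrow> 'b) \<Rightarrow> 'b \<Rightarrow> real"
  defines "P \<equiv> measure M {\<omega>\<in>space M. ereal (s (training_data n_train \<omega>) (Z (int i) \<omega>)) \<le>
    cal_quantile (1 - \<alpha>) {n_train + 1..n_train + n_cal} (\<lambda>j. s (training_data n_train \<omega>) (Z (int j) \<omega>))}"
  defines "\<epsilon> \<equiv> cal_term \<beta> n_cal \<delta> a m r + \<beta> (i - n_train) + \<delta>"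
  assumes s: "(\<lambda>(d, z). s d z) \<in> (Pi\<^sub>M {1..n_train} (\<lambda>_. N) \<Otimes>\<^sub>M N) \<rightarrow>\<^sub>M borel"
    and i: "n_train \<le> i" and F: "(a, m, r) \<in> F_cal \<beta> n_cal \<delta>" and \<alpha>: "0 < \<alpha>" "\<alpha> < 1"
  shows "1 - \<alpha> - \<epsilon> \<le> P"
    and "AE d in distr M (Pi\<^sub>M {1..n_train} (\<lambda>_. N)) (training_data n_train).
      \<forall>t. measure (distr (distr M N (Z 1)) borel (s d)) {t} = 0 \<Longrightarrow> P \<le> 1 - \<alpha> + \<epsilon>"
proof -
  define \<kappa> where "\<kappa> = \<delta> - 4 * (real m - 1) * \<beta> a - \<beta> r"
  define L where "L = ln (4 / \<kappa>)"
  have a: "a > 0" and m: "m > 0" and r: "r > 0" and \<kappa>: "\<kappa> > 0"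
    and "real (2 * m * a) = real n_cal - real r + 1"
    using F by (auto simp: F_cal_def \<kappa>_def)
  then have "real n_cal + 1 = real (2 * m * a + r)" by simp
  then have "n_cal + 1 = 2 * m * a + r" by linarith
  then have cal: "n_cal = 2 * m * a + (r - 1)" using r by simp
  have P: "0 \<le> P" "P \<le> 1" by (simp_all add: P_def)
  note \<beta> = beta_nonneg[of "i - n_train"]
  have \<kappa>\<delta>: "\<kappa> \<le> \<delta>"
  proof -
    have "0 \<le> 4 * (real m - 1) * \<beta> a" using m beta_nonneg[of a] by (intro mult_nonneg_nonneg) auto
    then show ?thesis using beta_nonneg[of r] unfolding \<kappa>_def by linarith
  qed
  have "1 - \<alpha> - \<epsilon> \<le> P \<and> ((AE d in distr M (Pi\<^sub>M {1..n_train} (\<lambda>_. N)) (training_data n_train).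
      \<forall>t. measure (distr (distr M N (Z 1)) borel (s d)) {t} = 0) \<longrightarrow> P \<le> 1 - \<alpha> + \<epsilon>)"
  proof (cases "\<kappa> > 4")
    case True
    then have "1 \<le> cal_term \<beta> n_cal \<delta> a m r + \<delta>"
      using cal_term_trivial[OF a m r cal] by (simp add: \<kappa>_def)
    then show ?thesis using P \<alpha> \<beta> by (auto simp: \<epsilon>_def)
  next
    case False
    have L: "L \<ge> 0" using False \<kappa> by (simp add: L_def)
    note ctx = s i L m a r cal \<alpha>
    have nc: "real n_cal - real r + 1 = 2 * (real m * real a)" using r by (simp add: cal of_nat_diff)
    have slack: "slack n_cal a m r L = cal_term \<beta> n_cal \<delta> a m r"
      using r unfolding slack_def[OF ctx] deviation_def cal_term_def nc \<kappa>_def[symmetric] L_def[symmetric]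
      by (simp add: of_nat_diff)
    have failure: "failure a m r L \<le> \<delta>"
    proof -
      \<comment> \<open>The origin of the 4 in the logarithm: \<open>failure\<close> becomes
        \<open>\<beta> r + 2 * (m - 1) * \<beta> a + \<kappa> / 2\<close>, which is at most
        \<open>\<beta> r + 4 * (m - 1) * \<beta> a + \<kappa> = \<delta>\<close>.\<close>
      have "exp (- L) = \<kappa> / 4" using \<kappa> by (simp add: L_def exp_minus)
      moreover define y where "y = (real m - 1) * \<beta> a"
      moreover have "0 \<le> y" unfolding y_def using m beta_nonneg[of a] by (intro mult_nonneg_nonneg) auto
      ultimately show ?thesis using \<kappa> unfolding failure_def[OF ctx] \<kappa>_def mult.assoc y_def[symmetric] by (simp add: field_simps)
    qed
    have cov: "P = measure M (covered n_train n_cal i \<alpha> s)"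
      unfolding P_def covered_def[OF ctx] score_def[OF ctx] ..
    have "1 - \<alpha> - \<epsilon> \<le> P"
    proof (cases "0 < 1 - \<alpha> - slack n_cal a m r L")
      case True
      then show ?thesis using coverage_lower[OF ctx] slack failure by (simp add: cov \<epsilon>_def)
    next
      case False
      then show ?thesis using P \<beta> \<kappa> \<kappa>\<delta> slack by (simp add: \<epsilon>_def)
    qed
    moreover have "P \<le> 1 - \<alpha> + \<epsilon>"
      if "AE d in distr M (Pi\<^sub>M {1..n_train} (\<lambda>_. N)) (training_data n_train).
        \<forall>t. measure (distr (distr M N (Z 1)) borel (s d)) {t} = 0"
    proof (cases "1 - \<alpha> + slack n_cal a m r L < 1")
      case True
      then show ?thesis
        using coverage_upper[OF ctx] that slack failure unfolding score_law_def[OF ctx] cov \<epsilon>_def by linarith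
    next
      case False
      then show ?thesis using P \<beta> \<kappa> \<kappa>\<delta> slack by (simp add: \<epsilon>_def)
    qed
    ultimately show ?thesis by blast
  qed
  then show "1 - \<alpha> - \<epsilon> \<le> P"
    and "AE d in distr M (Pi\<^sub>M {1..n_train} (\<lambda>_. N)) (training_data n_train).
      \<forall>t. measure (distr (distr M N (Z 1)) borel (s d)) {t} = 0 \<Longrightarrow> P \<le> 1 - \<alpha> + \<epsilon>"
    by blast+
qed

end

text \<open>Bounds for single triples are collected into the infimum here. If \<open>F_cal\<close>
  is empty, the infimum is \<open>\<infinity>\<close> and the claim holds trivially.\<close>

lemma eps_cal_ge:
  assumes "\<And>a m r. (a, m, r) \<in> F_cal \<beta> n_cal \<delta> \<Longrightarrow> x \<le> cal_term \<beta> n_cal \<delta> a m r"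
  shows "ereal x \<le> eps_cal \<beta> n_cal \<delta>"
  unfolding eps_cal_def
proof (rule INF_greatest, clarify)
  fix a m r assume "(a, m, r) \<in> F_cal \<beta> n_cal \<delta>"
  from assms[OF this] show "ereal x \<le> ereal (sigma_tilde \<beta> a * sqrt (4 / (real n_cal - real r + 1) *
      ln (4 / (\<delta> - 4 * (real m - 1) * \<beta> a - \<beta> r)))
      + 1 / (3 * real m) * ln (4 / (\<delta> - 4 * (real m - 1) * \<beta> a - \<beta> r)) + (real r - 1) / real n_cal)"
    by (simp only: cal_term_def ereal_less_eq(3))
qed

theorem theorem3p1:
  fixes M :: "'a measure" and MX :: "'x measure" and MY :: "'y measure"
    and Z :: "int \<Rightarrow> 'a \<Rightarrow> 'x \<times> 'y"
    and W :: "'a \<Rightarrow> 'x \<times> 'y"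
    and s :: "(nat \<Rightarrow> 'x \<times> 'y) \<Rightarrow> 'x \<times> 'y \<Rightarrow> real"
    and n n_train n_cal n_test i :: nat and \<alpha> \<delta>_cal :: real
  defines "N \<equiv> MX \<Otimes>\<^sub>M MY"
  defines "\<beta> \<equiv> beta_mix_coef M N Z"
  defines "D \<equiv> (\<lambda>\<omega>. \<lambda>j\<in>{1..n_train}. Z (int j) \<omega>)"
  defines "q \<equiv> (\<lambda>\<omega>. cal_quantile (1 - \<alpha>) {n_train + 1..n_train + n_cal}
                        (\<lambda>j. s (D \<omega>) (Z (int j) \<omega>)))"
  defines "P_cov \<equiv> measure M {\<omega>\<in>space M.
                        snd (Z (int i) \<omega>) \<in> conf_set s (D \<omega>) (q \<omega>) (fst (Z (int i) \<omega>))}"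
  defines "\<eta> \<equiv> eps_cal \<beta> n_cal \<delta>_cal + ereal (\<beta> (i - n_train)) + ereal \<delta>_cal"
  assumes "prob_space M"
    and Z_meas: "\<And>t. Z t \<in> M \<rightarrow>\<^sub>M N"
    and stat: "stationary_proc M N Z"
    and mixing: "\<beta> \<longlonglongrightarrow> 0"
    and W_meas: "W \<in> M \<rightarrow>\<^sub>M N"
    and W_indep: "prob_space.indep_set M
                  {(\<lambda>\<omega>. (\<lambda>j\<in>{1..n}. Z (int j) \<omega>)) -` A \<inter> space M | A. A \<in> sets (Pi\<^sub>M {1..n} (\<lambda>_. N))}
                  {W -` B \<inter> space M | B. B \<in> sets N}"
    and W_law: "distr M N W = distr M N (Z 1)"
    and s_meas: "(\<lambda>(d, z). s d z) \<in> (Pi\<^sub>M {1..n_train} (\<lambda>_. N) \<Otimes>\<^sub>M N) \<rightarrow>\<^sub>M borel"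
    and n_split: "n = n_train + n_cal + n_test"
    and "n_train > 0" and "n_cal > 0" and "n_test > 0"
    and "0 < \<alpha>" and "\<alpha> < 1" and "\<delta>_cal > 0"
    and i_test: "i \<in> {n_train + n_cal + 1..n}"
  shows "ereal P_cov \<ge> ereal (1 - \<alpha>) - \<eta> \<and>
         ((AE d in distr M (Pi\<^sub>M {1..n_train} (\<lambda>_. N)) D.
             \<forall>t. measure (distr M borel (\<lambda>\<omega>. s d (W \<omega>))) {t} = 0)
          \<longrightarrow> \<bar>ereal P_cov - ereal (1 - \<alpha>)\<bar> \<le> \<eta>)"
proof -
  interpret stationary_process M N Z
    using assms by (simp add: stationary_process_def stationary_process_axioms_def)
  have D: "D = training_data n_train"
    unfolding D_def training_data_def[abs_def] ..
  have P_cov: "P_cov = measure M {\<omega>\<in>space M. ereal (s (training_data n_train \<omega>) (Z (int i) \<omega>)) \<le>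
    cal_quantile (1 - \<alpha>) {n_train + 1..n_train + n_cal} (\<lambda>j. s (training_data n_train \<omega>) (Z (int j) \<omega>))}"
    unfolding P_cov_def q_def conf_set_def D by simp
  have i: "n_train \<le> i" using i_test by simp
  note cov = coverage[where n_cal = n_cal and \<delta> = \<delta>_cal, OF s_meas i _ \<open>0 < \<alpha>\<close> \<open>\<alpha> < 1\<close>, folded P_cov \<beta>_def]
  \<comment> \<open>The inequality is solved for the calibration term, the only part that depends on
    the triple, so that the infimum can be taken.\<close>
  have lower: "ereal (1 - \<alpha> - P_cov - \<beta> (i - n_train) - \<delta>_cal) \<le> eps_cal \<beta> n_cal \<delta>_cal"
    using cov(1) by (intro eps_cal_ge) (simp add: algebra_simps)
  \<comment> \<open>\<open>lower\<close> excludes the value \<open>-\<infinity>\<close> of the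
    infimum; for the value \<open>\<infinity>\<close> the error is infinite and nothing remains to
    be shown.\<close>
  then have 1: "ereal (1 - \<alpha>) - \<eta> \<le> ereal P_cov"
    unfolding \<eta>_def by (cases "eps_cal \<beta> n_cal \<delta>_cal") auto
  moreover have "\<bar>ereal P_cov - ereal (1 - \<alpha>)\<bar> \<le> \<eta>"
    if ae: "AE d in distr M (Pi\<^sub>M {1..n_train} (\<lambda>_. N)) D.
      \<forall>t. measure (distr M borel (\<lambda>\<omega>. s d (W \<omega>))) {t} = 0"
  proof -
    \<comment> \<open>For frozen training data the score of \<open>W\<close> has the law of the
      score of \<open>Z 1\<close>. Measurability of \<open>s d\<close> requires \<open>d\<close> in
      the product space, which holds almost everywhere.\<close>
    have "distr M borel (\<lambda>\<omega>. s d (W \<omega>)) = distr (distr M N (Z 1)) borel (s d)"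
      if d: "d \<in> space (Pi\<^sub>M {1..n_train} (\<lambda>_. N))" for d
      unfolding W_law[symmetric]
      using W_meas measurable_compose[OF measurable_Pair1'[OF d] s_meas] by (simp add: distr_distr comp_def)
    then have ae': "AE d in distr M (Pi\<^sub>M {1..n_train} (\<lambda>_. N)) (training_data n_train).
      \<forall>t. measure (distr (distr M N (Z 1)) borel (s d)) {t} = 0"
      using ae AE_space[of "distr M (Pi\<^sub>M {1..n_train} (\<lambda>_. N)) D"] unfolding D
      by (auto elim!: eventually_elim2)
    have "ereal (P_cov - (1 - \<alpha>) - \<beta> (i - n_train) - \<delta>_cal) \<le> eps_cal \<beta> n_cal \<delta>_cal"
      using cov(2)[OF _ ae'] by (intro eps_cal_ge) (simp add: algebra_simps)
    with lower show ?thesis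
      unfolding \<eta>_def by (cases "eps_cal \<beta> n_cal \<delta>_cal") auto
  qed
  ultimately show ?thesis by blast
qed

end
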